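(* Consider the persuasion game with $n\ge 2$ senders described in the context, under Assumption A (unique optimal actions) and Assumption B (possible alignment) stated there. Then every Nash equilibrium $\boldsymbol{\pi}=(\boldsymbol{\pi}_1,\ldots,\boldsymbol{\pi}_n)$ of the game is fully informative.
   Context: **Players, states, payoffs.** There are $n\ge 2$ senders $1,\ldots,n$ and one receiver $R$. The state space is the finite set $\Omega=\Omega_1\times\cdots\times\Omega_n\times\Omega_R$, with elements $\omega=(\omega_1,\ldots,\omega_n,\omega_R)$, and $\mu_0$ is a common prior over $\Omega$. The receiver is the only player with a payoff-relevant action; $A$ denotes his set of actions. Payoff functions are $u_R:A\times\Omega_R\to\mathbb{R}$ and $u_i:A\times\Omega_i\to\mathbb{R}$ for each sender $i$. $P$ denotes probability under $\mu_0$ (and the randomness of signals). **Assumption A.** For every $j\in\{1,\ldots,n,R\}$ and $\omega_j\in\Omega_j$, the set $\arg\max_{a\in A}u_j(a,\omega_j)$ is a singleton (identified with its element). **Assumption B.** For every pair of senders $i\ne j$ and every $(\omega_j,\omega_R)\in\Omega_j\times\Omega_R$ with positive probability under $\mu_0$, there exists $\omega_i\in\Omega_i$ with $P(\omega_i\mid(\omega_j,\omega_R))>0$ and $\arg\max_{a\in A}u_i(a,\omega_i)=\arg\max_{a\in A}u_R(a,\omega_R)$. **Signals.** A signal of sender $i$ consists of a message space $M_i\subseteq A$ and a function $\pi_i:\Omega_i\times\Omega_R\to\Delta(M_i)$, where $\Delta(\cdot)$ denotes the set of probability distributions. In state $\omega$ it generates a random message with distribution $\pi_i(\omega_i,\omega_R)$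 (conditionally on $(\omega_i,\omega_R)$, independent of the other coordinates of $\omega$), interpreted as a recommended action. $\mathrm{supp}(\pi_i)$ is the support of the message of $\pi_i$, i.e. the set of its possible realizations. For $a\in\mathrm{supp}(\pi_i)$, $\langle\pi_i\mid a\rangle$ is the posterior belief over $\Omega$ given that the realized message is $a$, and $\langle\pi_i\mid a\rangle_R$ is its marginal on $\Omega_R$. The signal $\pi_i$ is incentive compatible (IC) if, upon any realization $a\in A$ of $\pi_i$, the receiver's optimal action is $a$. Senders are restricted to IC signals (without loss of generality, by the revelation principle), and $\Pi_i$ denotes the set of all IC signals of sender $i$. For a signal $\pi$, $v_R(\pi)$ is the expected utility of the receiver when he takes his optimal action following every realization of $\pi$, and $v_i(\pi)$ is the expected utility of sender $i$ when the receiver takes these actions. For $k\in\{1,\ldots,n,R\}$ write $\pi\succeq_k\pi'$ if $v_k(\pi)\ge v_k(\pi')$. **Game.** Each sender $i$ chooses a probability distribution $\boldsymbol{\pi}_i$ over $\Pi_i$. The receiver observes the vector $(\pi_1,\ldots,\pi_n)$ drawn from $(\boldsymbol{\pi}_1,\ldots,\boldsymbol{\pi}_n)$ (independently across senders), and then chooses one sender according to the decision rule $D$: $D(\pi_1,\ldots,\pi_n)$ is a uniformly random element of $\{j:\pi_j\succeq_R\pi_i\ \forall i\in\{1,\ldots,n\}\}$. The state is then realized, the chosen sender $j$ learns $(\omega_j,\omega_R)$, the receiver gets only the message of the chosen sender's signal, takes an action in $A$, and payoffs are realized. **Nash equilibrium.** A profile $\boldsymbol{\pi}=(\boldsymbol{\pi}_1,\ldots,\boldsymbol{\pi}_n)$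 such that there do not exist a sender $i$ and a distribution $\boldsymbol{\pi}_i'$ over $\Pi_i$ with $E[v_i(\boldsymbol{\pi}'_{D(\boldsymbol{\pi}')})]>E[v_i(\boldsymbol{\pi}_{D(\boldsymbol{\pi})})]$, where $\boldsymbol{\pi}'$ is $\boldsymbol{\pi}$ with $\boldsymbol{\pi}_i$ replaced by $\boldsymbol{\pi}_i'$. Here $E[v_i(\boldsymbol{\pi}_{D(\boldsymbol{\pi})})]$ is the expectation of $v_i(\pi_{D(\pi_1,\ldots,\pi_n)})$ over the draw $(\pi_1,\ldots,\pi_n)$ from $\boldsymbol{\pi}$ and over $D$. **Fully informative.** A signal $\pi_i$ is fully informative if for every $a\in\mathrm{supp}(\pi_i)$ and every $\omega_R\in\mathrm{supp}(\langle\pi_i\mid a\rangle_R)$ we have $a=\arg\max_{b\in A}u_R(b,\omega_R)$. A profile $\boldsymbol{\pi}$ is fully informative if, with probability 1, the profile $(\pi_1,\ldots,\pi_n)$ drawn from $\boldsymbol{\pi}$ satisfies: for every sender $j$ that is chosen by the receiver with positive probability, $\pi_j$ is fully informative. *)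

theory Defs
  imports "HOL-Probability.Probability"
begin

text \<open>
  The sender indices form a finite type \<open>'i\<close>. The state sets of all senders live in a common type
  \<open>'s\<close>, but each sender has its own set. A state is a pair of the senders' coordinates and the
  receiver's coordinate.
\<close>

record ('i, 's, 'r, 'a) game =
  sender_states :: "'i \<Rightarrow> 's set"
  receiver_states :: "'r set"
  prior :: "(('i \<Rightarrow> 's) \<times> 'r) pmf"
  actions :: "'a set"
  sender_utility :: "'i \<Rightarrow> 'a \<Rightarrow> 's \<Rightarrow> real"
  receiver_utility :: "'a \<Rightarrow> 'r \<Rightarrow> real"

definition persuasion_game :: "('i::finite, 's, 'r, 'a) game \<Rightarrow> bool" where
  "persuasion_game G \<longleftrightarrow>
     CARD('i) \<ge> 2 \<and>
     (\<forall>i. finite (sender_states G i)) \<and>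
     finite (receiver_states G) \<and>
     set_pmf (prior G) \<subseteq> (\<Pi>\<^sub>E i\<in>UNIV. sender_states G i) \<times> receiver_states G"

definition argmax_on :: "'a set \<Rightarrow> ('a \<Rightarrow> real) \<Rightarrow> 'a set" where
  "argmax_on A f = {a. is_arg_max f (\<lambda>b. b \<in> A) a}"

definition unique_optimal_actions :: "('i::finite, 's, 'r, 'a) game \<Rightarrow> bool" where
  "unique_optimal_actions G \<longleftrightarrow>
     (\<forall>i. \<forall>w\<in>sender_states G i.
        is_singleton (argmax_on (actions G) (\<lambda>a. sender_utility G i a w))) \<and>
     (\<forall>w\<in>receiver_states G.
        is_singleton (argmax_on (actions G) (\<lambda>a. receiver_utility G a w)))"

definition possible_alignment :: "('i::finite, 's, 'r, 'a) game \<Rightarrow> bool" where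
  "possible_alignment G \<longleftrightarrow>
     (\<forall>i j. i \<noteq> j \<longrightarrow>
       (\<forall>wj\<in>sender_states G j. \<forall>wR\<in>receiver_states G.
          \<P>(\<omega> in measure_pmf (prior G). fst \<omega> j = wj \<and> snd \<omega> = wR) > 0 \<longrightarrow>
          (\<exists>wi\<in>sender_states G i.
             cond_prob (measure_pmf (prior G))
               (\<lambda>\<omega>. fst \<omega> i = wi) (\<lambda>\<omega>. fst \<omega> j = wj \<and> snd \<omega> = wR) > 0 \<and>
             argmax_on (actions G) (\<lambda>a. sender_utility G i a wi) =
             argmax_on (actions G) (\<lambda>a. receiver_utility G a wR))))"

text \<open>
  Expectation with values in the extended reals. The action set may be infinite and utilities may
  be unbounded below, so the expected utility of a sender can be \<open>-\<infinity>\<close>, where the Bochner integral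
  would return 0. Under unique optimal actions utilities are bounded above, so the difference never
  has the form \<open>\<infinity> - \<infinity>\<close>.
\<close>

definition expect :: "'b measure \<Rightarrow> ('b \<Rightarrow> ereal) \<Rightarrow> ereal" where
  "expect M f = enn2ereal (\<integral>\<^sup>+x. e2ennreal (f x) \<partial>M) - enn2ereal (\<integral>\<^sup>+x. e2ennreal (- f x) \<partial>M)"

lemma expect_eq_integral:
  fixes f :: "'b \<Rightarrow> real"
  assumes "integrable M f"
  shows "expect M (\<lambda>x. ereal (f x)) = ereal (\<integral>x. f x \<partial>M)"
proof -
  have fin: "(\<integral>\<^sup>+x. ennreal (f x) \<partial>M) \<noteq> \<infinity>" "(\<integral>\<^sup>+x. ennreal (- f x) \<partial>M) \<noteq> \<infinity>"
    using assms by (auto simp: real_integrable_def)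
  have conv: "enn2ereal x = ereal (enn2real x)" if "x \<noteq> \<infinity>" for x
    using that by (cases x) (auto simp: enn2ereal_ennreal)
  show ?thesis
    using conv[OF fin(1)] conv[OF fin(2)]
    by (simp add: expect_def real_lebesgue_integral_def[OF assms] flip: ennreal.abs_eq)
qed

text \<open>A signal maps the chosen sender's information to a distribution over recommended actions.\<close>

type_synonym ('s, 'r, 'a) signal = "'s \<times> 'r \<Rightarrow> 'a pmf"

definition is_signal ::
  "('i::finite, 's, 'r, 'a) game \<Rightarrow> 'i \<Rightarrow> 'a set \<Rightarrow> ('s, 'r, 'a) signal \<Rightarrow> bool" where
  "is_signal G i M \<pi> \<longleftrightarrow> M \<subseteq> actions G \<and>
     \<pi> \<in> (sender_states G i \<times> receiver_states G) \<rightarrow>\<^sub>E {p. set_pmf p \<subseteq> M}"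

definition state_message ::
  "('i::finite, 's, 'r, 'a) game \<Rightarrow> 'i \<Rightarrow> ('s, 'r, 'a) signal \<Rightarrow> ((('i \<Rightarrow> 's) \<times> 'r) \<times> 'a) pmf" where
  "state_message G i \<pi> = bind_pmf (prior G) (\<lambda>\<omega>. map_pmf (Pair \<omega>) (\<pi> (fst \<omega> i, snd \<omega>)))"

definition signal_supp ::
  "('i::finite, 's, 'r, 'a) game \<Rightarrow> 'i \<Rightarrow> ('s, 'r, 'a) signal \<Rightarrow> 'a set" where
  "signal_supp G i \<pi> = set_pmf (map_pmf snd (state_message G i \<pi>))"

text \<open>Only meaningful when \<open>a\<close> is in the support of the signal, as \<^const>\<open>cond_pmf\<close> requires.\<close>

definition posterior ::
  "('i::finite, 's, 'r, 'a) game \<Rightarrow> 'i \<Rightarrow> ('s, 'r, 'a) signal \<Rightarrow> 'a \<Rightarrow> (('i \<Rightarrow> 's) \<times> 'r) pmf" where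
  "posterior G i \<pi> a = map_pmf fst (cond_pmf (state_message G i \<pi>) {x. snd x = a})"

definition posterior_R ::
  "('i::finite, 's, 'r, 'a) game \<Rightarrow> 'i \<Rightarrow> ('s, 'r, 'a) signal \<Rightarrow> 'a \<Rightarrow> 'r pmf" where
  "posterior_R G i \<pi> a = map_pmf snd (posterior G i \<pi> a)"

text \<open>
  Optimality of the recommendation is weak: other actions may be optimal at the same posterior, and
  the receiver then follows the recommendation.
\<close>

definition incentive_compatible ::
  "('i::finite, 's, 'r, 'a) game \<Rightarrow> 'i \<Rightarrow> ('s, 'r, 'a) signal \<Rightarrow> bool" where
  "incentive_compatible G i \<pi> \<longleftrightarrow>
     (\<forall>a\<in>signal_supp G i \<pi>.
        a \<in> argmax_on (actions G)
              (\<lambda>b. measure_pmf.expectation (posterior_R G i \<pi> a) (receiver_utility G b)))"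

definition IC_signals :: "('i::finite, 's, 'r, 'a) game \<Rightarrow> 'i \<Rightarrow> ('s, 'r, 'a) signal set" where
  "IC_signals G i = {\<pi>. (\<exists>M. is_signal G i M \<pi>) \<and> incentive_compatible G i \<pi>}"

text \<open>
  Values of a signal of sender \<open>j\<close> to the receiver and to sender \<open>i\<close>, for incentive compatible
  signals: the optimal action after each message is the message itself.
\<close>

definition receiver_value ::
  "('i::finite, 's, 'r, 'a) game \<Rightarrow> 'i \<Rightarrow> ('s, 'r, 'a) signal \<Rightarrow> ereal" where
  "receiver_value G j \<pi> =
     expect (measure_pmf (state_message G j \<pi>)) (\<lambda>(\<omega>, a). ereal (receiver_utility G a (snd \<omega>)))"

definition sender_value ::
  "('i::finite, 's, 'r, 'a) game \<Rightarrow> 'i \<Rightarrow> 'i \<Rightarrow> ('s, 'r, 'a) signal \<Rightarrow> ereal" where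
  "sender_value G i j \<pi> =
     expect (measure_pmf (state_message G j \<pi>)) (\<lambda>(\<omega>, a). ereal (sender_utility G i a (fst \<omega> i)))"

text \<open>
  The set of incentive compatible signals carries the \<open>\<sigma>\<close>-algebra generated by the maps
  \<open>\<pi> \<mapsto> \<pi> (w, w\<^sub>R) S\<close> for sets \<open>S\<close> of actions. For a finite action set this is the Borel
  \<open>\<sigma>\<close>-algebra of the polytope of incentive compatible signals. A mixed strategy is an arbitrary,
  not necessarily discrete, probability measure on it.
\<close>

definition pmf_algebra :: "'a pmf measure" where
  "pmf_algebra = vimage_algebra UNIV measure_pmf (subprob_algebra (count_space UNIV))"

definition signal_space ::
  "('i::finite, 's, 'r, 'a) game \<Rightarrow> 'i \<Rightarrow> ('s, 'r, 'a) signal measure" where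
  "signal_space G i =
     restrict_space (\<Pi>\<^sub>M w\<in>sender_states G i \<times> receiver_states G. pmf_algebra) (IC_signals G i)"

definition mixed_strategies ::
  "('i::finite, 's, 'r, 'a) game \<Rightarrow> 'i \<Rightarrow> ('s, 'r, 'a) signal measure set" where
  "mixed_strategies G i = space (prob_algebra (signal_space G i))"

definition decision ::
  "('i::finite, 's, 'r, 'a) game \<Rightarrow> ('i \<Rightarrow> ('s, 'r, 'a) signal) \<Rightarrow> 'i pmf" where
  "decision G \<pi> = pmf_of_set {j. \<forall>i. receiver_value G j (\<pi> j) \<ge> receiver_value G i (\<pi> i)}"

definition expected_payoff ::
  "('i::finite, 's, 'r, 'a) game \<Rightarrow> 'i \<Rightarrow> ('i \<Rightarrow> ('s, 'r, 'a) signal measure) \<Rightarrow> ereal" where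
  "expected_payoff G i \<sigma> =
     expect (\<Pi>\<^sub>M j\<in>UNIV. \<sigma> j)
       (\<lambda>\<pi>. expect (measure_pmf (decision G \<pi>)) (\<lambda>j. sender_value G i j (\<pi> j)))"

definition nash_equilibrium ::
  "('i::finite, 's, 'r, 'a) game \<Rightarrow> ('i \<Rightarrow> ('s, 'r, 'a) signal measure) \<Rightarrow> bool" where
  "nash_equilibrium G \<sigma> \<longleftrightarrow>
     (\<forall>i. \<sigma> i \<in> mixed_strategies G i) \<and>
     \<not> (\<exists>i. \<exists>\<tau>\<in>mixed_strategies G i. expected_payoff G i (\<sigma>(i := \<tau>)) > expected_payoff G i \<sigma>)"

definition fully_informative ::
  "('i::finite, 's, 'r, 'a) game \<Rightarrow> 'i \<Rightarrow> ('s, 'r, 'a) signal \<Rightarrow> bool" where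
  "fully_informative G i \<pi> \<longleftrightarrow>
     (\<forall>a\<in>signal_supp G i \<pi>. \<forall>wR\<in>set_pmf (posterior_R G i \<pi> a).
        argmax_on (actions G) (\<lambda>b. receiver_utility G b wR) = {a})"

definition fully_informative_profile ::
  "('i::finite, 's, 'r, 'a) game \<Rightarrow> ('i \<Rightarrow> ('s, 'r, 'a) signal measure) \<Rightarrow> bool" where
  "fully_informative_profile G \<sigma> \<longleftrightarrow>
     (AE \<pi> in (\<Pi>\<^sub>M j\<in>UNIV. \<sigma> j). \<forall>j\<in>set_pmf (decision G \<pi>). fully_informative G j (\<pi> j))"

end

(*
  Payoffs are measured by risks: the expected shortfall of a player's utility from the optimum in the
  current state. For IC signals the receiver's risk is finite, and it vanishes exactly for full
  revelation.

  By possible alignment, sender i can improve on any IC signal of a rival j that is not fully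
  informative: he imitates it by resampling omega_j from his own information, and in aligned states he
  sometimes reveals the receiver's optimum. This multiplies the receiver's risk by 1 - c, with c
  independent of the signal, and strictly lowers the risk of sender i.

  Suppose that the winning risk W of an equilibrium is not almost surely 0, and let b be its essential
  supremum. Near b all senders do badly simultaneously: for T slightly below b, the event W > T is the
  product event that every sender's signal has receiver risk above T. Some sender i wins at most half
  of the time on this event. Let psi(x) be the least risk of sender i among his own IC signals with
  receiver risk below x; it is convex. A supporting line of psi at T, applied to i's own winning
  signals (receiver risk at most b) and to his improvements of the winning signals of rivals (receiver
  risk at most (1 - c) b), shows that his average risk on the event exceeds psi(T). So he gains by
  replacing all his signals of receiver risk above T by a single signal with receiver risk below T and
  own risk close to psi(T). Outside the event this can only cost epsilon, because his improvement of a
  rival's signal of receiver risk at most T was already available to him.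
*)

theory Submission
  imports Defs
begin

section \<open>Expectations, conditioning and product measures\<close>

text \<open>The case infinity minus infinity cannot arise: the positive part of \<open>h - g\<close>
  lies below that of \<open>h\<close> and so has a finite integral. The identity \<open>pt\<close>
  expresses \<open>h - g = p - q\<close> without subtraction, so it can be integrated in
  \<open>ennreal\<close> and rearranged afterwards.\<close>

lemma expect_diff:
  fixes h :: "'b \<Rightarrow> real" and g :: "'b \<Rightarrow> ennreal"
  assumes h: "integrable M h" and g [measurable]: "g \<in> borel_measurable M"
  shows "expect M (\<lambda>x. ereal (h x) - enn2ereal (g x)) = ereal (\<integral>x. h x \<partial>M) - enn2ereal (\<integral>\<^sup>+x. g x \<partial>M)"
proof -
  define p where "p x = e2ennreal (ereal (h x) - enn2ereal (g x))" for x
  define q where "q x = e2ennreal (- (ereal (h x) - enn2ereal (g x)))" for x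
  have [measurable]: "h \<in> borel_measurable M" using h by simp
  have [measurable]: "p \<in> borel_measurable M" "q \<in> borel_measurable M"
    unfolding p_def q_def by measurable
  have e2: "e2ennreal (ereal r) = ennreal r" for r by (simp add: ennreal.abs_eq)
  have pt: "p x + g x + ennreal (- h x) = q x + ennreal (h x)" for x
  proof (cases "g x")
    case (real r)
    then show ?thesis
      by (cases "h x \<ge> 0"; cases "h x \<ge> r")
         (auto simp: p_def q_def e2 enn2ereal_ennreal ennreal_neg simp flip: ennreal_plus)
  next
    case top
    then show ?thesis by (simp add: p_def q_def e2ennreal_neg)
  qed
  have le: "p x \<le> ennreal (h x)" for x
  proof (cases "g x")
    case (real r)
    then show ?thesis by (auto simp: p_def e2 enn2ereal_ennreal intro: ennreal_leI)
  next
    case top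
    then show ?thesis by (simp add: p_def e2ennreal_neg)
  qed
  let ?P = "\<integral>\<^sup>+x. p x \<partial>M" and ?Q = "\<integral>\<^sup>+x. q x \<partial>M" and ?G = "\<integral>\<^sup>+x. g x \<partial>M"
  let ?A = "\<integral>\<^sup>+x. ennreal (h x) \<partial>M" and ?B = "\<integral>\<^sup>+x. ennreal (- h x) \<partial>M"
  have sum: "?P + ?G + ?B = ?Q + ?A"
    by (simp add: pt flip: nn_integral_add)
  have fin: "?A < \<infinity>" "?B < \<infinity>" using h by (auto simp: real_integrable_def less_top)
  have "?P \<le> ?A" by (intro nn_integral_mono le)
  with fin have "?P < \<infinity>" by (simp add: order.strict_trans1)
  then obtain P where P: "?P = ennreal P" "P \<ge> 0" by (cases ?P) auto
  obtain A where A: "?A = ennreal A" "A \<ge> 0" using fin by (cases ?A) auto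
  obtain B where B: "?B = ennreal B" "B \<ge> 0" using fin by (cases ?B) auto
  have int: "(\<integral>x. h x \<partial>M) = A - B"
    using A B by (simp add: real_lebesgue_integral_def[OF h])
  have "enn2ereal ?P - enn2ereal ?Q = ereal (A - B) - enn2ereal ?G"
  proof (cases ?G)
    case (real G)
    then have "?Q < \<infinity>" using sum P A B
      by (metis ennreal_add_less_top ennreal_less_top infinity_ennreal_def less_top top_add)
    then obtain Q where Q: "?Q = ennreal Q" "Q \<ge> 0" by (cases ?Q) auto
    have "P + G + B = Q + A" using sum real P A B Q by (simp flip: ennreal_plus)
    then show ?thesis using real P A B Q by (simp add: enn2ereal_ennreal)
  next
    case top
    then have "?Q = \<infinity>" using sum A by (cases ?Q) (auto simp flip: ennreal_plus)
    then show ?thesis using top P by (simp add: enn2ereal_ennreal)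
  qed
  then show ?thesis by (simp add: expect_def int p_def q_def)
qed

lemma expect_cong:
  assumes "\<And>x. x \<in> space M \<Longrightarrow> f x = g x"
  shows "expect M f = expect M g"
  unfolding expect_def using assms by (simp cong: nn_integral_cong)

lemma expect_cong_AE:
  assumes "AE x in M. f x = g x"
  shows "expect M f = expect M g"
proof -
  have "(\<integral>\<^sup>+x. e2ennreal (f x) \<partial>M) = (\<integral>\<^sup>+x. e2ennreal (g x) \<partial>M)"
    "(\<integral>\<^sup>+x. e2ennreal (- f x) \<partial>M) = (\<integral>\<^sup>+x. e2ennreal (- g x) \<partial>M)"
    using assms by (auto intro!: nn_integral_cong_AE)
  then show ?thesis by (simp add: expect_def)
qed

section \<open>Disintegration of a pmf over the fibres of a map\<close>

lemma bind_cond_pmf_fibre: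
  "bind_pmf p (\<lambda>x. cond_pmf p {y. f y = f x}) = p"
  by (rule bind_cond_pmf_cancel) (auto intro!: arg_cong[where f = "measure_pmf.prob p"])

lemma nn_integral_cond_pmf:
  assumes "set_pmf p \<inter> S \<noteq> {}"
  shows "(\<integral>\<^sup>+x. g x \<partial>cond_pmf p S) = (\<integral>\<^sup>+x. g x * indicator S x \<partial>p) / emeasure p S"
  by (simp add: cond_pmf.rep_eq[OF assms] nn_integral_uniform_measure)

text \<open>Tower property: resampling \<open>y\<close> in the fibre of \<open>x\<close> reproduces
  the law \<open>p\<close>, and the first argument of \<open>g\<close> cannot tell \<open>x\<close>
  from \<open>y\<close>.\<close>

lemma nn_integral_cond_pmf_tower:
  fixes p :: "'b pmf" and g :: "'c \<Rightarrow> 'b \<Rightarrow> ennreal"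
  shows
  "(\<integral>\<^sup>+x. \<integral>\<^sup>+y. g (f x) y \<partial>cond_pmf p {y. f y = f x} \<partial>p) = (\<integral>\<^sup>+x. g (f x) x \<partial>p)"
proof -
  have "(\<integral>\<^sup>+x. g (f x) x \<partial>p) = (\<integral>\<^sup>+x. \<integral>\<^sup>+y. g (f y) y \<partial>cond_pmf p {y. f y = f x} \<partial>p)"
    by (subst (1) bind_cond_pmf_fibre[of p f, symmetric]) simp
  also have "\<dots> = (\<integral>\<^sup>+x. \<integral>\<^sup>+y. g (f x) y \<partial>cond_pmf p {y. f y = f x} \<partial>p)"
  proof (rule nn_integral_cong_AE, rule AE_pmfI)
    fix x assume "x \<in> set_pmf p"
    then have "set_pmf p \<inter> {y. f y = f x} \<noteq> {}" by auto
    then show "(\<integral>\<^sup>+y. g (f y) y \<partial>cond_pmf p {y. f y = f x}) = (\<integral>\<^sup>+y. g (f x) y \<partial>cond_pmf p {y. f y = f x})"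
      by (intro nn_integral_cong_AE AE_pmfI) (simp add: set_cond_pmf)
  qed
  finally show ?thesis ..
qed

section \<open>Transforming one factor of a product measure\<close>

lemma measurable_fun_upd_component:
  assumes f [measurable]: "f \<in> M i \<rightarrow>\<^sub>M M i"
  shows "(\<lambda>x. x(i := f (x i))) \<in> PiM UNIV M \<rightarrow>\<^sub>M PiM UNIV M"
proof (rule measurable_PiM_single')
  fix j show "(\<lambda>x. (x(i := f (x i))) j) \<in> PiM UNIV M \<rightarrow>\<^sub>M M j"
    by (cases "j = i") auto
qed (auto simp: space_PiM PiE_iff intro!: measurable_space[OF f])

text \<open>Lets a deviation of one sender be computed on the original space of draws. Rectangles
  suffice, since the preimage of a rectangle under the update is again a rectangle.\<close>

lemma PiM_fun_upd_distr:
  fixes M :: "'i::finite \<Rightarrow> 'b measure"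
  assumes prob: "\<And>j. prob_space (M j)" and f [measurable]: "f \<in> M i \<rightarrow>\<^sub>M M i"
  shows "PiM UNIV (M(i := distr (M i) (M i) f)) = distr (PiM UNIV M) (PiM UNIV M) (\<lambda>x. x(i := f (x i)))"
proof -
  let ?N = "M(i := distr (M i) (M i) f)"
  have pN: "prob_space (?N j)" for j
    using prob by (auto intro: prob_space.prob_space_distr)
  interpret M: product_prob_space M UNIV
    by (rule product_prob_spaceI) (rule prob)
  interpret N: product_prob_space ?N UNIV
    by (rule product_prob_spaceI) (rule pN)
  have s: "sets (PiM UNIV ?N) = sets (PiM UNIV M)"
    by (intro sets_PiM_cong) auto
  note m [measurable] = measurable_fun_upd_component[of f M i, OF f]
  show ?thesis
  proof (rule N.PiM_eqI[symmetric])
    show "sets (distr (PiM UNIV M) (PiM UNIV M) (\<lambda>x. x(i := f (x i)))) = sets (PiM UNIV ?N)"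
      using s by simp
    fix A assume "\<And>j. j \<in> UNIV \<Longrightarrow> A j \<in> sets (?N j)"
    then have A: "A j \<in> sets (M j)" for j by (metis UNIV_I fun_upd_apply sets_distr)
    have [measurable]: "Pi\<^sub>E UNIV A \<in> sets (PiM UNIV M)" using A by (intro sets_PiM_I_finite) auto
    let ?B = "A(i := f -` A i \<inter> space (M i))"
    have B: "?B j \<in> sets (M j)" for j using A by auto
    have "(\<lambda>x. x(i := f (x i))) -` Pi\<^sub>E UNIV A \<inter> space (PiM UNIV M) = Pi\<^sub>E UNIV ?B"
      using sets.sets_into_space[OF A] by (auto simp: space_PiM PiE_iff split: if_splits) blast
    then have "emeasure (distr (PiM UNIV M) (PiM UNIV M) (\<lambda>x. x(i := f (x i)))) (Pi\<^sub>E UNIV A) = emeasure (PiM UNIV M) (Pi\<^sub>E UNIV ?B)"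
      by (subst emeasure_distr) auto
    also have "\<dots> = (\<Prod>j\<in>UNIV. emeasure (M j) (?B j))"
      using B by (intro M.emeasure_PiM) auto
    also have "\<dots> = (\<Prod>j\<in>UNIV. emeasure (?N j) (A j))"
      using A by (intro prod.cong) (auto simp: emeasure_distr)
    finally show "emeasure (distr (PiM UNIV M) (PiM UNIV M) (\<lambda>x. x(i := f (x i)))) (Pi\<^sub>E UNIV A) = (\<Prod>j\<in>UNIV. emeasure (?N j) (A j))" .
  qed simp
qed

lemma borel_measurable_nn_integral_pmf_algebra:
  "(\<lambda>p. \<integral>\<^sup>+x. g x \<partial>measure_pmf p) \<in> borel_measurable pmf_algebra"
proof -
  have "measure_pmf \<in> pmf_algebra \<rightarrow>\<^sub>M subprob_algebra (count_space UNIV)"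
    unfolding pmf_algebra_def
    by (rule measurable_vimage_algebra1) (auto simp: space_subprob_algebra measure_pmf.subprob_space_axioms)
  then show ?thesis
    by (rule measurable_compose) (rule nn_integral_measurable_subprob_algebra, simp)
qed

lemma argmax_on_singletonD:
  assumes "argmax_on A f = {x}"
  shows "x \<in> A" "a \<in> A \<Longrightarrow> f a \<le> f x" "a \<in> A \<Longrightarrow> f a = f x \<Longrightarrow> a = x"
proof -
  have x: "is_arg_max f (\<lambda>b. b \<in> A) x" using assms by (auto simp: argmax_on_def)
  then show "x \<in> A" by (simp add: is_arg_max_def)
  show le: "f a \<le> f x" if "a \<in> A" for a using x that by (auto simp: is_arg_max_def not_less)
  show "a = x" if "a \<in> A" "f a = f x"
  proof -
    have "is_arg_max f (\<lambda>b. b \<in> A) a" using that le by (auto simp: is_arg_max_def not_less)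
    then show ?thesis using assms by (auto simp: argmax_on_def)
  qed
qed

section \<open>Losses and incentive compatibility\<close>

locale persuasion =
  fixes G :: "('i::finite, 's, 'r, 'a) game"
  assumes game: "persuasion_game G"
    and unique: "unique_optimal_actions G"
    and align: "possible_alignment G"
begin

definition receiver_opt :: "'r \<Rightarrow> 'a" where
  "receiver_opt r = the_elem (argmax_on (actions G) (\<lambda>a. receiver_utility G a r))"

definition sender_opt :: "'i \<Rightarrow> 's \<Rightarrow> 'a" where
  "sender_opt i w = the_elem (argmax_on (actions G) (\<lambda>a. sender_utility G i a w))"

text \<open>With values in \<open>ennreal\<close>, integrals of losses need no integrability
  conditions. The truncation at 0 changes nothing for actions and states of the game, where
  \<open>receiver_opt\<close> is maximal (\<open>enn2ereal_receiver_loss\<close>).\<close>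

definition receiver_loss :: "'a \<Rightarrow> 'r \<Rightarrow> ennreal" where
  "receiver_loss a r = ennreal (receiver_utility G (receiver_opt r) r - receiver_utility G a r)"

definition sender_loss :: "'i \<Rightarrow> 'a \<Rightarrow> 's \<Rightarrow> ennreal" where
  "sender_loss i a w = ennreal (sender_utility G i (sender_opt i w) w - sender_utility G i a w)"

lemma finite_receiver_states: "finite (receiver_states G)"
  using game by (simp add: persuasion_game_def)

lemma finite_sender_states: "finite (sender_states G i)"
  using game by (simp add: persuasion_game_def)

lemma prior_states:
  assumes "\<omega> \<in> set_pmf (prior G)"
  shows "fst \<omega> i \<in> sender_states G i" "snd \<omega> \<in> receiver_states G"
  using assms game by (fastforce simp: persuasion_game_def)+

lemma finite_prior: "finite (set_pmf (prior G))"
proof (rule finite_subset)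
  show "set_pmf (prior G) \<subseteq> (\<Pi>\<^sub>E i\<in>UNIV. sender_states G i) \<times> receiver_states G"
    using game by (simp add: persuasion_game_def)
  show "finite ((\<Pi>\<^sub>E i\<in>UNIV. sender_states G i) \<times> receiver_states G)"
    by (intro finite_cartesian_product finite_PiE finite_receiver_states) (auto simp: finite_sender_states)
qed

lemma integrable_prior: "integrable (measure_pmf (prior G)) (f :: _ \<Rightarrow> real)"
  by (intro integrable_measure_pmf_finite finite_prior)

lemma argmax_receiver:
  assumes "r \<in> receiver_states G"
  shows "argmax_on (actions G) (\<lambda>a. receiver_utility G a r) = {receiver_opt r}"
  using assms unique unfolding unique_optimal_actions_def receiver_opt_def is_singleton_the_elem by blast

lemma argmax_sender:
  assumes "w \<in> sender_states G i"
  shows "argmax_on (actions G) (\<lambda>a. sender_utility G i a w) = {sender_opt i w}"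
  using assms unique unfolding unique_optimal_actions_def sender_opt_def is_singleton_the_elem by blast

lemma receiver_opt_action: "r \<in> receiver_states G \<Longrightarrow> receiver_opt r \<in> actions G"
  using argmax_on_singletonD(1)[OF argmax_receiver] .

lemma receiver_loss_eq_0_iff:
  "r \<in> receiver_states G \<Longrightarrow> a \<in> actions G \<Longrightarrow> receiver_loss a r = 0 \<longleftrightarrow> a = receiver_opt r"
  using argmax_on_singletonD(2,3)[OF argmax_receiver]
  by (fastforce simp: receiver_loss_def ennreal_eq_0_iff intro: antisym)

lemma sender_loss_eq_0_iff:
  "w \<in> sender_states G i \<Longrightarrow> a \<in> actions G \<Longrightarrow> sender_loss i a w = 0 \<longleftrightarrow> a = sender_opt i w"
  using argmax_on_singletonD(2,3)[OF argmax_sender]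
  by (fastforce simp: sender_loss_def ennreal_eq_0_iff intro: antisym)

lemma receiver_opt_loss [simp]: "receiver_loss (receiver_opt r) r = 0"
  by (simp add: receiver_loss_def)

lemma enn2ereal_receiver_loss:
  "r \<in> receiver_states G \<Longrightarrow> a \<in> actions G \<Longrightarrow>
    enn2ereal (receiver_loss a r) = ereal (receiver_utility G (receiver_opt r) r - receiver_utility G a r)"
  using argmax_on_singletonD(2)[OF argmax_receiver] by (simp add: receiver_loss_def enn2ereal_ennreal)

lemma enn2ereal_sender_loss:
  "w \<in> sender_states G i \<Longrightarrow> a \<in> actions G \<Longrightarrow>
    enn2ereal (sender_loss i a w) = ereal (sender_utility G i (sender_opt i w) w - sender_utility G i a w)"
  using argmax_on_singletonD(2)[OF argmax_sender] by (simp add: sender_loss_def enn2ereal_ennreal)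

text \<open>Possible alignment in terms of the support of the prior: a positive conditional
  probability yields an aligned state in the support that neither sender \<open>j\<close> nor the
  receiver's coordinate can tell from \<open>\<omega>\<close>.\<close>

lemma aligned_state:
  assumes "i \<noteq> j" "\<omega> \<in> set_pmf (prior G)"
  obtains \<omega>' where "\<omega>' \<in> set_pmf (prior G)" "fst \<omega>' j = fst \<omega> j" "snd \<omega>' = snd \<omega>"
    "sender_opt i (fst \<omega>' i) = receiver_opt (snd \<omega>')"
proof -
  let ?p = "measure_pmf (prior G)"
  have "\<P>(\<omega>' in ?p. fst \<omega>' j = fst \<omega> j \<and> snd \<omega>' = snd \<omega>) > 0"
    using assms(2) by (auto intro!: measure_pmf_posI)
  then obtain wi where wi: "wi \<in> sender_states G i"
    "cond_prob ?p (\<lambda>\<omega>'. fst \<omega>' i = wi) (\<lambda>\<omega>'. fst \<omega>' j = fst \<omega> j \<and> snd \<omega>' = snd \<omega>) > 0"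
    "argmax_on (actions G) (\<lambda>a. sender_utility G i a wi) = argmax_on (actions G) (\<lambda>a. receiver_utility G a (snd \<omega>))"
    using align assms prior_states[OF assms(2)] unfolding possible_alignment_def by blast
  have "\<P>(\<omega>' in ?p. fst \<omega>' i = wi \<and> fst \<omega>' j = fst \<omega> j \<and> snd \<omega>' = snd \<omega>) \<noteq> 0"
    using wi(2) by (auto simp: cond_prob_def)
  then obtain \<omega>' where "\<omega>' \<in> set_pmf (prior G)" "fst \<omega>' i = wi" "fst \<omega>' j = fst \<omega> j" "snd \<omega>' = snd \<omega>"
    by (auto simp: measure_pmf_zero_iff)
  moreover have "sender_opt i wi = receiver_opt (snd \<omega>)"
    using wi argmax_sender[OF wi(1)] argmax_receiver[OF prior_states(2)[OF assms(2)]] by simp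
  ultimately show ?thesis by (intro that[of \<omega>']) auto
qed

section \<open>The joint law of state and message\<close>

lemma nn_integral_state_message:
  "(\<integral>\<^sup>+x. F x \<partial>state_message G j \<pi>) = (\<integral>\<^sup>+\<omega>. \<integral>\<^sup>+a. F (\<omega>, a) \<partial>\<pi> (fst \<omega> j, snd \<omega>) \<partial>prior G)"
  by (simp add: state_message_def)

lemma set_state_message:
  "set_pmf (state_message G j \<pi>) =
    {(\<omega>, a). \<omega> \<in> set_pmf (prior G) \<and> a \<in> set_pmf (\<pi> (fst \<omega> j, snd \<omega>))}"
  by (auto simp: state_message_def)

text \<open>Message spaces disappear here, since each can be enlarged to the whole action set
  (\<open>is_signal_iff\<close>).\<close>

definition valid_signal :: "'i \<Rightarrow> ('s, 'r, 'a) signal \<Rightarrow> bool" where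
  "valid_signal j \<pi> \<longleftrightarrow> \<pi> \<in> (sender_states G j \<times> receiver_states G) \<rightarrow>\<^sub>E {p. set_pmf p \<subseteq> actions G}"

lemma valid_signal_actions:
  assumes "valid_signal j \<pi>" "\<omega> \<in> set_pmf (prior G)" "a \<in> set_pmf (\<pi> (fst \<omega> j, snd \<omega>))"
  shows "a \<in> actions G"
  using assms prior_states[OF assms(2)] by (fastforce simp: valid_signal_def dest!: PiE_mem)

lemma state_message_props:
  assumes "valid_signal j \<pi>" "x \<in> set_pmf (state_message G j \<pi>)"
  shows "fst (fst x) i \<in> sender_states G i" "snd (fst x) \<in> receiver_states G" "snd x \<in> actions G"
  using assms prior_states valid_signal_actions by (fastforce simp: set_state_message)+

lemma is_signal_iff: "(\<exists>M. is_signal G j M \<pi>) \<longleftrightarrow> valid_signal j \<pi>"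
proof
  assume "\<exists>M. is_signal G j M \<pi>"
  then show "valid_signal j \<pi>" unfolding is_signal_def valid_signal_def by (auto simp: PiE_iff)
next
  assume "valid_signal j \<pi>"
  then have "is_signal G j (actions G) \<pi>" unfolding is_signal_def valid_signal_def by auto
  then show "\<exists>M. is_signal G j M \<pi>" ..
qed

text \<open>
  Incentive compatibility in a form that is linear in the joint law of state and message.
\<close>

definition obedient :: "'i \<Rightarrow> ('s, 'r, 'a) signal \<Rightarrow> bool" where
  "obedient j \<pi> \<longleftrightarrow> (\<forall>a\<in>actions G. \<forall>b\<in>actions G.
     (\<integral>\<^sup>+x. receiver_loss a (snd (fst x)) * indicator {a} (snd x) \<partial>state_message G j \<pi>)
     \<le> (\<integral>\<^sup>+x. receiver_loss b (snd (fst x)) * indicator {a} (snd x) \<partial>state_message G j \<pi>))"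

text \<open>At a posterior, the expected utility of an action is a constant \<open>V\<close>, common
  to all actions, minus its expected loss; so maximal utility means minimal loss. Multiplying by the
  probability of the message clears the denominator of the posterior, and for messages outside the
  support both sides vanish.\<close>

lemma IC_signals_iff: "\<pi> \<in> IC_signals G j \<longleftrightarrow> valid_signal j \<pi> \<and> obedient j \<pi>"
proof (cases "valid_signal j \<pi>")
  case valid: True
  let ?q = "state_message G j \<pi>"
  have supp: "a \<in> actions G" if "a \<in> signal_supp G j \<pi>" for a
    using that state_message_props(3)[OF valid] by (fastforce simp: signal_supp_def)
  have nonsupp: "(\<integral>\<^sup>+x. receiver_loss b (snd (fst x)) * indicator {a} (snd x) \<partial>?q) = 0"
    if "a \<notin> signal_supp G j \<pi>" for a b
    using that
    by (subst nn_integral_0_iff_AE) (auto simp: AE_measure_pmf_iff signal_supp_def indicator_def)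
  have main: "measure_pmf.expectation (posterior_R G j \<pi> a) (receiver_utility G b)
      \<le> measure_pmf.expectation (posterior_R G j \<pi> a) (receiver_utility G a) \<longleftrightarrow>
     (\<integral>\<^sup>+x. receiver_loss a (snd (fst x)) * indicator {a} (snd x) \<partial>?q)
     \<le> (\<integral>\<^sup>+x. receiver_loss b (snd (fst x)) * indicator {a} (snd x) \<partial>?q)"
    if a: "a \<in> signal_supp G j \<pi>" and b: "b \<in> actions G" for a b
  proof -
    let ?S = "{x. snd x = a}" and ?r = "posterior_R G j \<pi> a"
    have ne: "set_pmf ?q \<inter> ?S \<noteq> {}" using a by (auto simp: signal_supp_def)
    have r: "?r = map_pmf (\<lambda>x. snd (fst x)) (cond_pmf ?q ?S)"
      by (simp add: posterior_R_def posterior_def map_pmf_comp)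
    have sub: "set_pmf ?r \<subseteq> receiver_states G"
      using ne state_message_props(2)[OF valid] by (auto simp: r set_cond_pmf)
    then have int: "integrable (measure_pmf ?r) f" for f :: "'r \<Rightarrow> real"
      using finite_receiver_states by (intro integrable_measure_pmf_finite) (auto intro: finite_subset)
    define V where "V = measure_pmf.expectation ?r (\<lambda>r. receiver_utility G (receiver_opt r) r)"
    have eq: "(\<integral>\<^sup>+r. receiver_loss c r \<partial>?r) = ennreal (V - measure_pmf.expectation ?r (receiver_utility G c))"
      and le: "measure_pmf.expectation ?r (receiver_utility G c) \<le> V"
      if "c \<in> actions G" for c
    proof -
      have *: "receiver_utility G c r \<le> receiver_utility G (receiver_opt r) r" if "r \<in> set_pmf ?r" for r
        using argmax_on_singletonD(2)[OF argmax_receiver] \<open>c \<in> actions G\<close> sub that by blast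
      show "(\<integral>\<^sup>+r. receiver_loss c r \<partial>?r) = ennreal (V - measure_pmf.expectation ?r (receiver_utility G c))"
        unfolding receiver_loss_def V_def
        by (subst nn_integral_eq_integral) (auto intro!: int AE_pmfI * simp: Bochner_Integration.integral_diff int)
      show "measure_pmf.expectation ?r (receiver_utility G c) \<le> V"
        unfolding V_def by (intro integral_mono_AE int AE_pmfI *)
    qed
    have cond: "(\<integral>\<^sup>+x. receiver_loss c (snd (fst x)) * indicator {a} (snd x) \<partial>?q) =
        (\<integral>\<^sup>+r. receiver_loss c r \<partial>?r) * emeasure ?q ?S" for c
    proof -
      have self: "emeasure ?q ?S / emeasure ?q ?S = 1"
        using ne by (intro ennreal_divide_self) (auto simp: measure_pmf.emeasure_eq_measure measure_pmf_zero_iff)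
      have "(\<integral>\<^sup>+r. receiver_loss c r \<partial>?r) =
        (\<integral>\<^sup>+x. receiver_loss c (snd (fst x)) * indicator ?S x \<partial>?q) / emeasure ?q ?S"
        by (simp add: r nn_integral_cond_pmf[OF ne])
      also have "(\<integral>\<^sup>+x. receiver_loss c (snd (fst x)) * indicator ?S x \<partial>?q) =
        (\<integral>\<^sup>+x. receiver_loss c (snd (fst x)) * indicator {a} (snd x) \<partial>?q)"
        by (intro nn_integral_cong) (auto simp: indicator_def)
      finally show ?thesis
        by (simp add: ennreal_divide_times self)
    qed
    have "0 < emeasure ?q ?S" "emeasure ?q ?S < top"
      using ne by (auto simp: measure_pmf.emeasure_eq_measure zero_less_iff_neq_zero measure_pmf_zero_iff)
    then show ?thesis
      using eq[OF b] eq[OF supp[OF a]] le[OF b] le[OF supp[OF a]]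
      by (auto simp: cond ennreal_mult_le_mult_iff mult.commute[of _ "emeasure ?q ?S"])
  qed
  have "incentive_compatible G j \<pi> \<longleftrightarrow> obedient j \<pi>"
    unfolding obedient_def
  proof (intro iffI ballI)
    fix a b assume ic: "incentive_compatible G j \<pi>" and ab: "a \<in> actions G" "b \<in> actions G"
    show "(\<integral>\<^sup>+x. receiver_loss a (snd (fst x)) * indicator {a} (snd x) \<partial>?q)
      \<le> (\<integral>\<^sup>+x. receiver_loss b (snd (fst x)) * indicator {a} (snd x) \<partial>?q)"
    proof (cases "a \<in> signal_supp G j \<pi>")
      case True
      then show ?thesis using ic ab
        by (subst main[symmetric]) (auto simp: incentive_compatible_def argmax_on_def is_arg_max_def not_less)
    qed (simp add: nonsupp)
  next
    assume ob: "\<forall>a\<in>actions G. \<forall>b\<in>actions G.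
     (\<integral>\<^sup>+x. receiver_loss a (snd (fst x)) * indicator {a} (snd x) \<partial>?q)
     \<le> (\<integral>\<^sup>+x. receiver_loss b (snd (fst x)) * indicator {a} (snd x) \<partial>?q)"
    then show "incentive_compatible G j \<pi>"
      using supp main by (simp add: incentive_compatible_def argmax_on_def is_arg_max_def not_less)
  qed
  then show ?thesis using valid by (auto simp: IC_signals_def is_signal_iff)
qed (simp add: IC_signals_def is_signal_iff)

section \<open>Risks of signals\<close>

definition receiver_risk :: "'i \<Rightarrow> ('s, 'r, 'a) signal \<Rightarrow> ennreal" where
  "receiver_risk j \<pi> = (\<integral>\<^sup>+x. receiver_loss (snd x) (snd (fst x)) \<partial>state_message G j \<pi>)"

definition sender_risk :: "'i \<Rightarrow> 'i \<Rightarrow> ('s, 'r, 'a) signal \<Rightarrow> ennreal" where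
  "sender_risk i j \<pi> = (\<integral>\<^sup>+x. sender_loss i (snd x) (fst (fst x) i) \<partial>state_message G j \<pi>)"

definition receiver_max :: real where
  "receiver_max = (\<integral>\<omega>. receiver_utility G (receiver_opt (snd \<omega>)) (snd \<omega>) \<partial>prior G)"

definition sender_max :: "'i \<Rightarrow> real" where
  "sender_max i = (\<integral>\<omega>. sender_utility G i (sender_opt i (fst \<omega> i)) (fst \<omega> i) \<partial>prior G)"

lemma map_fst_state_message: "map_pmf fst (state_message G j \<pi>) = prior G"
  by (simp add: state_message_def map_bind_pmf map_pmf_comp bind_return_pmf')

text \<open>The state has the prior as its marginal law whatever the signal, so a signal affects a
  payoff only through the loss term.\<close>

lemma expect_state_message:
  assumes "AE x in state_message G j \<pi>. u x = ereal (h (fst x)) - enn2ereal (l x)"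
  shows "expect (state_message G j \<pi>) u =
    ereal (\<integral>\<omega>. h \<omega> \<partial>prior G) - enn2ereal (\<integral>\<^sup>+x. l x \<partial>state_message G j \<pi>)"
proof -
  have int: "integrable (state_message G j \<pi>) (\<lambda>x. h (fst x))"
    using integrable_prior[of h] by (simp flip: map_fst_state_message[of j \<pi>])
  have "expect (state_message G j \<pi>) u = expect (state_message G j \<pi>) (\<lambda>x. ereal (h (fst x)) - enn2ereal (l x))"
    by (rule expect_cong_AE[OF assms])
  also have "\<dots> = ereal (\<integral>x. h (fst x) \<partial>state_message G j \<pi>) - enn2ereal (\<integral>\<^sup>+x. l x \<partial>state_message G j \<pi>)"
    by (intro expect_diff int) simp
  also have "(\<integral>x. h (fst x) \<partial>state_message G j \<pi>) = (\<integral>\<omega>. h \<omega> \<partial>map_pmf fst (state_message G j \<pi>))"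
    by simp
  finally show ?thesis by (simp add: map_fst_state_message)
qed

lemma receiver_value_eq:
  assumes "valid_signal j \<pi>"
  shows "receiver_value G j \<pi> = ereal receiver_max - enn2ereal (receiver_risk j \<pi>)"
  unfolding receiver_value_def receiver_risk_def receiver_max_def
  using state_message_props[OF assms]
  by (intro expect_state_message AE_pmfI) (auto simp: enn2ereal_receiver_loss split: prod.splits)

lemma sender_value_eq:
  assumes "valid_signal j \<pi>"
  shows "sender_value G i j \<pi> = ereal (sender_max i) - enn2ereal (sender_risk i j \<pi>)"
  unfolding sender_value_def sender_risk_def sender_max_def
proof (intro expect_state_message AE_pmfI)
  fix x assume "x \<in> set_pmf (state_message G j \<pi>)"
  from state_message_props(1,3)[OF assms this]
  show "(case x of (\<omega>, a) \<Rightarrow> ereal (sender_utility G i a (fst \<omega> i))) =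
    ereal (sender_utility G i (sender_opt i (fst (fst x) i)) (fst (fst x) i)) -
    enn2ereal (sender_loss i (snd x) (fst (fst x) i))"
    by (auto simp: enn2ereal_sender_loss split: prod.splits)
qed

lemma nn_integral_prior_finite:
  assumes "\<And>\<omega>. f \<omega> < \<infinity>"
  shows "(\<integral>\<^sup>+\<omega>. f \<omega> \<partial>prior G) < \<infinity>"
  using assms by (auto simp: nn_integral_measure_pmf_finite finite_prior ennreal_mult_less_top)

text \<open>The receiver could ignore the message and always play \<open>b\<close>. By obedience
  this is no better after any single message, and averaging over the messages gives the
  claim.\<close>

lemma receiver_risk_le:
  assumes "\<pi> \<in> IC_signals G j" "b \<in> actions G"
  shows "receiver_risk j \<pi> \<le> (\<integral>\<^sup>+\<omega>. receiver_loss b (snd \<omega>) \<partial>prior G)"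
proof -
  let ?q = "state_message G j \<pi>"
  have valid: "valid_signal j \<pi>" and ob: "obedient j \<pi>" using assms by (auto simp: IC_signals_iff)
  have "receiver_risk j \<pi> = (\<integral>\<^sup>+x. \<integral>\<^sup>+y. receiver_loss (snd x) (snd (fst y)) \<partial>cond_pmf ?q {y. snd y = snd x} \<partial>?q)"
    unfolding receiver_risk_def by (rule nn_integral_cond_pmf_tower[symmetric, where g = "\<lambda>a y. receiver_loss a (snd (fst y))"])
  also have "\<dots> \<le> (\<integral>\<^sup>+x. \<integral>\<^sup>+y. receiver_loss b (snd (fst y)) \<partial>cond_pmf ?q {y. snd y = snd x} \<partial>?q)"
  proof (rule nn_integral_mono_AE, rule AE_pmfI)
    fix x assume x: "x \<in> set_pmf ?q"
    then have ne: "set_pmf ?q \<inter> {y. snd y = snd x} \<noteq> {}" by auto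
    have ind: "indicator {y. snd y = snd x} y = (indicator {snd x} (snd y) :: ennreal)" for y :: "(('i \<Rightarrow> 's) \<times> 'r) \<times> 'a"
      by (simp add: indicator_def)
    show "(\<integral>\<^sup>+y. receiver_loss (snd x) (snd (fst y)) \<partial>cond_pmf ?q {y. snd y = snd x})
      \<le> (\<integral>\<^sup>+y. receiver_loss b (snd (fst y)) \<partial>cond_pmf ?q {y. snd y = snd x})"
      using ob assms(2) state_message_props(3)[OF valid x]
      by (auto simp: nn_integral_cond_pmf[OF ne] ind obedient_def intro!: divide_right_mono_ennreal)
  qed
  also have "\<dots> = (\<integral>\<^sup>+x. receiver_loss b (snd (fst x)) \<partial>?q)"
    by (rule nn_integral_cond_pmf_tower[where g = "\<lambda>a y. receiver_loss b (snd (fst y))"])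
  also have "\<dots> = (\<integral>\<^sup>+\<omega>. receiver_loss b (snd \<omega>) \<partial>map_pmf fst ?q)" by simp
  finally show ?thesis by (simp add: map_fst_state_message)
qed

text \<open>One bound serves all senders and signals, even for an infinite action set with utilities
  unbounded below: take as fixed action the receiver's optimum in some state of the support.\<close>

lemma receiver_risk_bound:
  obtains B :: real where "B \<ge> 0" "\<And>j \<pi>. \<pi> \<in> IC_signals G j \<Longrightarrow> receiver_risk j \<pi> \<le> ennreal B"
proof -
  obtain \<omega> where "\<omega> \<in> set_pmf (prior G)" using set_pmf_not_empty by fast
  then have "receiver_opt (snd \<omega>) \<in> actions G" using prior_states receiver_opt_action by blast
  then obtain b where b: "b \<in> actions G" by blast
  let ?B = "\<integral>\<^sup>+\<omega>. receiver_loss b (snd \<omega>) \<partial>prior G"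
  have "?B < \<infinity>" by (rule nn_integral_prior_finite) (simp add: receiver_loss_def)
  then obtain B where "?B = ennreal B" "B \<ge> 0" by (cases ?B) auto
  then show ?thesis using that receiver_risk_le b by metis
qed

lemma receiver_risk_eq_0:
  assumes "valid_signal j \<pi>" "receiver_risk j \<pi> = 0" "x \<in> set_pmf (state_message G j \<pi>)"
  shows "snd x = receiver_opt (snd (fst x))"
proof -
  have "receiver_loss (snd x) (snd (fst x)) = 0"
    using assms(2,3) by (auto simp: receiver_risk_def nn_integral_0_iff_AE AE_measure_pmf_iff)
  then show ?thesis using state_message_props[OF assms(1,3)] receiver_loss_eq_0_iff by blast
qed

lemma fully_informativeI:
  assumes "valid_signal j \<pi>" "receiver_risk j \<pi> = 0"
  shows "fully_informative G j \<pi>"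
  unfolding fully_informative_def
proof (intro ballI)
  fix a r assume a: "a \<in> signal_supp G j \<pi>" and r: "r \<in> set_pmf (posterior_R G j \<pi> a)"
  have ne: "set_pmf (state_message G j \<pi>) \<inter> {x. snd x = a} \<noteq> {}" using a by (auto simp: signal_supp_def)
  from r obtain x where x: "x \<in> set_pmf (state_message G j \<pi>)" "snd x = a" "snd (fst x) = r"
    by (auto simp: posterior_R_def posterior_def set_cond_pmf[OF ne])
  then show "argmax_on (actions G) (\<lambda>b. receiver_utility G b r) = {a}"
    using argmax_receiver[OF state_message_props(2)[OF assms(1) x(1)]] receiver_risk_eq_0[OF assms x(1)] by simp
qed

section \<open>Full revelation and mixtures of signals\<close>

definition full_risk :: "'i \<Rightarrow> ennreal" where
  "full_risk i = (\<integral>\<^sup>+\<omega>. sender_loss i (receiver_opt (snd \<omega>)) (fst \<omega> i) \<partial>prior G)"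

lemma full_risk_finite: "full_risk i < \<infinity>"
  unfolding full_risk_def by (rule nn_integral_prior_finite) (simp add: sender_loss_def)

text \<open>All signals without receiver risk induce the same joint law of state and message,
  whoever sends them.\<close>

lemma sender_risk_full:
  assumes "valid_signal j \<pi>" "receiver_risk j \<pi> = 0"
  shows "sender_risk i j \<pi> = full_risk i"
proof -
  have "sender_risk i j \<pi> = (\<integral>\<^sup>+x. sender_loss i (receiver_opt (snd (fst x))) (fst (fst x) i) \<partial>state_message G j \<pi>)"
    unfolding sender_risk_def
    by (intro nn_integral_cong_AE AE_pmfI) (simp add: receiver_risk_eq_0[OF assms])
  also have "\<dots> = (\<integral>\<^sup>+\<omega>. sender_loss i (receiver_opt (snd \<omega>)) (fst \<omega> i) \<partial>map_pmf fst (state_message G j \<pi>))"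
    by simp
  finally show ?thesis by (simp add: map_fst_state_message full_risk_def)
qed

lemma full_signal:
  obtains \<pi> where "\<pi> \<in> IC_signals G i" "receiver_risk i \<pi> = 0"
proof -
  define \<pi> where "\<pi> = (\<lambda>y\<in>sender_states G i \<times> receiver_states G. return_pmf (receiver_opt (snd y)))"
  have valid: "valid_signal i \<pi>"
    by (auto simp: valid_signal_def \<pi>_def intro!: receiver_opt_action)
  have int: "(\<integral>\<^sup>+x. F x \<partial>state_message G i \<pi>) = (\<integral>\<^sup>+\<omega>. F (\<omega>, receiver_opt (snd \<omega>)) \<partial>prior G)" for F
    unfolding nn_integral_state_message
    by (intro nn_integral_cong_AE AE_pmfI) (auto simp: \<pi>_def prior_states)
  have "(\<integral>\<^sup>+x. receiver_loss a (snd (fst x)) * indicator {a} (snd x) \<partial>state_message G i \<pi>) = 0" for a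
    unfolding int by (subst nn_integral_0_iff_AE) (auto simp: indicator_def)
  then have "\<pi> \<in> IC_signals G i" using valid by (simp add: IC_signals_iff obedient_def)
  moreover have "receiver_risk i \<pi> = 0" by (simp add: receiver_risk_def int)
  ultimately show ?thesis by (rule that)
qed

text \<open>A private coin with bias \<open>s\<close> selects the signal. The obedience inequalities
  are linear in the joint law of state and message, so they survive although the receiver does not
  see the coin.\<close>

lemma mix_signal:
  assumes \<pi>: "\<pi> \<in> IC_signals G i" and \<pi>': "\<pi>' \<in> IC_signals G i" and s: "0 \<le> s" "s \<le> 1"
  obtains \<rho> where "\<rho> \<in> IC_signals G i"
    "receiver_risk i \<rho> = ennreal s * receiver_risk i \<pi> + ennreal (1 - s) * receiver_risk i \<pi>'"
    "sender_risk i i \<rho> = ennreal s * sender_risk i i \<pi> + ennreal (1 - s) * sender_risk i i \<pi>'"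
proof -
  define \<rho> where "\<rho> = (\<lambda>y\<in>sender_states G i \<times> receiver_states G.
    bind_pmf (bernoulli_pmf s) (\<lambda>B. if B then \<pi> y else \<pi>' y))"
  have v: "valid_signal i \<pi>" "obedient i \<pi>" "valid_signal i \<pi>'" "obedient i \<pi>'"
    using \<pi> \<pi>' by (auto simp: IC_signals_iff)
  have valid: "valid_signal i \<rho>"
    using v(1,3) by (fastforce simp: valid_signal_def \<rho>_def PiE_iff extensional_def split: if_splits)
  have int: "(\<integral>\<^sup>+x. F x \<partial>state_message G i \<rho>) =
      ennreal s * (\<integral>\<^sup>+x. F x \<partial>state_message G i \<pi>) + ennreal (1 - s) * (\<integral>\<^sup>+x. F x \<partial>state_message G i \<pi>')" for F
  proof -
    have "(\<integral>\<^sup>+x. F x \<partial>state_message G i \<rho>) =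
      (\<integral>\<^sup>+\<omega>. ennreal s * (\<integral>\<^sup>+a. F (\<omega>, a) \<partial>\<pi> (fst \<omega> i, snd \<omega>)) + ennreal (1 - s) * (\<integral>\<^sup>+a. F (\<omega>, a) \<partial>\<pi>' (fst \<omega> i, snd \<omega>)) \<partial>prior G)"
      unfolding nn_integral_state_message
      by (intro nn_integral_cong_AE AE_pmfI) (use s in \<open>auto simp: \<rho>_def prior_states mult.commute\<close>)
    then show ?thesis
      by (simp add: nn_integral_state_message nn_integral_add nn_integral_cmult)
  qed
  have "obedient i \<rho>"
    using v(2,4) unfolding obedient_def int by (intro ballI add_mono mult_left_mono) auto
  then have "\<rho> \<in> IC_signals G i" using valid by (simp add: IC_signals_iff)
  then show ?thesis by (rule that) (simp_all add: receiver_risk_def sender_risk_def int)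
qed

section \<open>Improving on a rival\<close>

definition aligned :: "'i \<Rightarrow> ('i \<Rightarrow> 's) \<times> 'r \<Rightarrow> bool" where
  "aligned i \<omega> \<longleftrightarrow> sender_opt i (fst \<omega> i) = receiver_opt (snd \<omega>)"

definition align_prob :: "'i \<Rightarrow> 'i \<Rightarrow> ('i \<Rightarrow> 's) \<times> 'r \<Rightarrow> real" where
  "align_prob i j \<omega> = measure_pmf.prob
     (cond_pmf (prior G) {\<omega>'. (fst \<omega>' j, snd \<omega>') = (fst \<omega> j, snd \<omega>)}) {\<omega>'. aligned i \<omega>'}"

lemma align_prob_pos:
  assumes "i \<noteq> j" "\<omega> \<in> set_pmf (prior G)"
  shows "align_prob i j \<omega> > 0"
proof -
  let ?S = "{\<omega>'. (fst \<omega>' j, snd \<omega>') = (fst \<omega> j, snd \<omega>)}"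
  obtain \<omega>' where "\<omega>' \<in> set_pmf (prior G)" "fst \<omega>' j = fst \<omega> j" "snd \<omega>' = snd \<omega>" "aligned i \<omega>'"
    using aligned_state[OF assms] by (metis aligned_def)
  moreover have "set_pmf (prior G) \<inter> ?S \<noteq> {}" using assms by auto
  ultimately show ?thesis
    unfolding align_prob_def by (intro measure_pmf_posI[of \<omega>']) (auto simp: set_cond_pmf)
qed

text \<open>A minimum of finitely many positive numbers. The extra element 1/2 makes the set
  nonempty and keeps \<open>c\<close> below 1.\<close>

lemma align_prob_bound:
  obtains c where "0 < c" "c < 1" "\<forall>i j. \<forall>\<omega>\<in>set_pmf (prior G). i \<noteq> j \<longrightarrow> c \<le> align_prob i j \<omega>"
proof -
  let ?S = "insert (1/2) ((\<lambda>(i, j, \<omega>). align_prob i j \<omega>) ` {(i, j, \<omega>). i \<noteq> j \<and> \<omega> \<in> set_pmf (prior G)})"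
  have fin: "finite ?S"
    by (intro finite.insertI finite_imageI, rule finite_subset[of _ "UNIV \<times> UNIV \<times> set_pmf (prior G)"])
       (auto simp: finite_prior)
  have "Min ?S > 0" using fin align_prob_pos by (subst Min_gr_iff) auto
  moreover have "Min ?S \<le> 1/2" using fin by (intro Min_le) auto
  moreover have "Min ?S \<le> align_prob i j \<omega>" if "i \<noteq> j" "\<omega> \<in> set_pmf (prior G)" for i j \<omega>
    using fin that by (intro Min_le insertI2 image_eqI[of _ _ "(i, j, \<omega>)"]) auto
  ultimately show ?thesis by (intro that[of "Min ?S"]) auto
qed

text \<open>
  Sender \<open>i\<close> imitates a signal of sender \<open>j\<close>: he draws \<open>\<omega>\<^sub>j\<close> from its conditional law given his own
  information, which leaves the joint law of \<open>(\<omega>\<^sub>i, \<omega>\<^sub>R)\<close> and the message unchanged. In aligned states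
  he instead reveals the receiver's optimum, at a rate chosen such that revelation has probability
  exactly \<open>c\<close> given \<open>(\<omega>\<^sub>j, \<omega>\<^sub>R)\<close>. To the receiver the result is therefore a mixture of the imitated
  signal and full revelation, so that incentive compatibility is preserved.
\<close>

lemma improved_signal:
  assumes ij: "i \<noteq> j" and \<pi>: "\<pi> \<in> IC_signals G j" and c: "0 < c" "c < 1"
    and c_le: "\<And>\<omega>. \<omega> \<in> set_pmf (prior G) \<Longrightarrow> c \<le> align_prob i j \<omega>"
  obtains \<pi>' where "\<pi>' \<in> IC_signals G i" "receiver_risk i \<pi>' = ennreal (1 - c) * receiver_risk j \<pi>"
    "sender_risk i i \<pi>' \<le> sender_risk i j \<pi>"
    "receiver_risk j \<pi> > 0 \<longrightarrow> sender_risk i j \<pi> < \<infinity> \<longrightarrow> sender_risk i i \<pi>' < sender_risk i j \<pi>"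
proof -
  let ?p = "prior G"
  define f where "f \<omega> = (fst \<omega> i, snd \<omega>)" for \<omega> :: "('i \<Rightarrow> 's) \<times> 'r"
  define g where "g \<omega> = (fst \<omega> j, snd \<omega>)" for \<omega> :: "('i \<Rightarrow> 's) \<times> 'r"
  define \<rho> where "\<rho> \<omega> = (if aligned i \<omega> then c / align_prob i j \<omega> else 0)" for \<omega>
  define \<kappa> where "\<kappa> y \<omega> = bind_pmf (bernoulli_pmf (\<rho> \<omega>))
    (\<lambda>B. if B then return_pmf (receiver_opt (snd y)) else \<pi> (g \<omega>))" for y :: "'s \<times> 'r" and \<omega>
  \<comment> \<open>Pairs outside the support of the prior also need a distribution over actions;
    the receiver's optimum is the default there.\<close>
  define \<pi>' where "\<pi>' = (\<lambda>y\<in>sender_states G i \<times> receiver_states G.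
    if y \<in> f ` set_pmf ?p then bind_pmf (cond_pmf ?p {\<omega>. f \<omega> = y}) (\<kappa> y) else return_pmf (receiver_opt (snd y)))"
  have v: "valid_signal j \<pi>" "obedient j \<pi>" using \<pi> by (auto simp: IC_signals_iff)
  have \<rho>: "0 \<le> \<rho> \<omega>" "\<rho> \<omega> \<le> 1" if "\<omega> \<in> set_pmf ?p" for \<omega>
    using c_le[OF that] c by (auto simp: \<rho>_def)
  have valid: "valid_signal i \<pi>'"
    unfolding valid_signal_def
  proof (rule PiE_I)
    fix y assume y: "y \<in> sender_states G i \<times> receiver_states G"
    have opt: "receiver_opt (snd y) \<in> actions G" using y by (auto intro: receiver_opt_action)
    have "set_pmf (\<pi>' y) \<subseteq> actions G"
    proof (cases "y \<in> f ` set_pmf ?p")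
      case True
      then have ne: "set_pmf ?p \<inter> {\<omega>. f \<omega> = y} \<noteq> {}" by auto
      show ?thesis using True y valid_signal_actions[OF v(1)] opt
        by (auto simp: \<pi>'_def set_cond_pmf[OF ne] \<kappa>_def g_def split: if_splits)
    qed (use y opt in \<open>auto simp: \<pi>'_def\<close>)
    then show "\<pi>' y \<in> {p. set_pmf p \<subseteq> actions G}" by simp
  qed (simp add: \<pi>'_def)
  \<comment> \<open>The integrand sees the state only through \<open>f\<close>, so by the tower
    property the resampled state may be replaced by the true one.\<close>
  have int: "(\<integral>\<^sup>+x. F (f (fst x)) (snd x) \<partial>state_message G i \<pi>') =
      (\<integral>\<^sup>+\<omega>. ennreal (\<rho> \<omega>) * F (f \<omega>) (receiver_opt (snd \<omega>)) \<partial>?p) +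
      (\<integral>\<^sup>+\<omega>. ennreal (1 - \<rho> \<omega>) * (\<integral>\<^sup>+a. F (f \<omega>) a \<partial>\<pi> (g \<omega>)) \<partial>?p)" for F
  proof -
    have "(\<integral>\<^sup>+x. F (f (fst x)) (snd x) \<partial>state_message G i \<pi>') = (\<integral>\<^sup>+\<omega>. \<integral>\<^sup>+a. F (f \<omega>) a \<partial>\<pi>' (f \<omega>) \<partial>?p)"
      by (simp add: nn_integral_state_message f_def)
    also have "\<dots> = (\<integral>\<^sup>+\<omega>. \<integral>\<^sup>+\<omega>'. \<integral>\<^sup>+a. F (f \<omega>) a \<partial>\<kappa> (f \<omega>) \<omega>' \<partial>cond_pmf ?p {\<omega>'. f \<omega>' = f \<omega>} \<partial>?p)"
    proof (rule nn_integral_cong_AE, rule AE_pmfI)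
      fix \<omega> assume "\<omega> \<in> set_pmf ?p"
      then have "\<pi>' (f \<omega>) = bind_pmf (cond_pmf ?p {\<omega>'. f \<omega>' = f \<omega>}) (\<kappa> (f \<omega>))"
        by (auto simp: \<pi>'_def f_def prior_states)
      then show "(\<integral>\<^sup>+a. F (f \<omega>) a \<partial>\<pi>' (f \<omega>)) = (\<integral>\<^sup>+\<omega>'. \<integral>\<^sup>+a. F (f \<omega>) a \<partial>\<kappa> (f \<omega>) \<omega>' \<partial>cond_pmf ?p {\<omega>'. f \<omega>' = f \<omega>})"
        by simp
    qed
    also have "\<dots> = (\<integral>\<^sup>+\<omega>. \<integral>\<^sup>+a. F (f \<omega>) a \<partial>\<kappa> (f \<omega>) \<omega> \<partial>?p)"
      by (rule nn_integral_cond_pmf_tower[where g = "\<lambda>y \<omega>'. \<integral>\<^sup>+a. F y a \<partial>\<kappa> y \<omega>'"])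
    also have "\<dots> = (\<integral>\<^sup>+\<omega>. ennreal (\<rho> \<omega>) * F (f \<omega>) (receiver_opt (snd \<omega>)) +
        ennreal (1 - \<rho> \<omega>) * (\<integral>\<^sup>+a. F (f \<omega>) a \<partial>\<pi> (g \<omega>)) \<partial>?p)"
      by (intro nn_integral_cong_AE AE_pmfI) (auto simp: \<kappa>_def \<rho> mult.commute f_def)
    finally show ?thesis by (simp add: nn_integral_add)
  qed
  \<comment> \<open>Used with \<open>r\<close> equal to \<open>\<rho>\<close> and to
    \<open>1 - \<rho>\<close>, whose averages over each fibre of \<open>g\<close> are the constants
    \<open>c\<close> and \<open>1 - c\<close>.\<close>
  have tower: "(\<integral>\<^sup>+\<omega>. r \<omega> * H (g \<omega>) \<partial>?p) = d * (\<integral>\<^sup>+\<omega>. H (g \<omega>) \<partial>?p)"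
    if "\<And>\<omega>. \<omega> \<in> set_pmf ?p \<Longrightarrow> (\<integral>\<^sup>+\<omega>'. r \<omega>' \<partial>cond_pmf ?p {\<omega>'. g \<omega>' = g \<omega>}) = d"
    for r :: "_ \<Rightarrow> ennreal" and H d
  proof -
    have "(\<integral>\<^sup>+\<omega>. r \<omega> * H (g \<omega>) \<partial>?p) = (\<integral>\<^sup>+\<omega>. \<integral>\<^sup>+\<omega>'. r \<omega>' * H (g \<omega>) \<partial>cond_pmf ?p {\<omega>'. g \<omega>' = g \<omega>} \<partial>?p)"
      by (rule nn_integral_cond_pmf_tower[symmetric, where g = "\<lambda>y \<omega>'. r \<omega>' * H y"])
    also have "\<dots> = (\<integral>\<^sup>+\<omega>. d * H (g \<omega>) \<partial>?p)"
      by (intro nn_integral_cong_AE AE_pmfI) (simp add: nn_integral_multc that)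
    finally show ?thesis by (simp add: nn_integral_cmult)
  qed
  have cond_\<rho>: "(\<integral>\<^sup>+\<omega>'. ennreal (\<rho> \<omega>') \<partial>cond_pmf ?p {\<omega>'. g \<omega>' = g \<omega>}) = ennreal c" (is ?c1)
    and cond_\<rho>': "(\<integral>\<^sup>+\<omega>'. ennreal (1 - \<rho> \<omega>') \<partial>cond_pmf ?p {\<omega>'. g \<omega>' = g \<omega>}) = ennreal (1 - c)" (is ?c2)
    if \<omega>: "\<omega> \<in> set_pmf ?p" for \<omega>
  proof -
    let ?q = "cond_pmf ?p {\<omega>'. g \<omega>' = g \<omega>}"
    have ne: "set_pmf ?p \<inter> {\<omega>'. g \<omega>' = g \<omega>} \<noteq> {}" using \<omega> by auto
    have ap: "align_prob i j \<omega>' = measure_pmf.prob (cond_pmf ?p {\<omega>''. g \<omega>'' = g \<omega>'}) {\<omega>'. aligned i \<omega>'}" for \<omega>'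
      by (simp add: align_prob_def g_def)
    have pos: "align_prob i j \<omega> > 0" using c c_le[OF \<omega>] by simp
    \<comment> \<open>Since \<open>align_prob\<close> is constant on a fibre of \<open>g\<close>,
      \<open>\<rho>\<close> is there a multiple of the indicator of alignment.\<close>
    have "(\<integral>\<^sup>+\<omega>'. ennreal (\<rho> \<omega>') \<partial>?q) = (\<integral>\<^sup>+\<omega>'. ennreal (c / align_prob i j \<omega>) * indicator {\<omega>'. aligned i \<omega>'} \<omega>' \<partial>?q)"
      by (intro nn_integral_cong_AE AE_pmfI)
         (auto simp: set_cond_pmf[OF ne] \<rho>_def indicator_def ap)
    also have "\<dots> = ennreal (c / align_prob i j \<omega>) * ennreal (align_prob i j \<omega>)"
      by (simp add: nn_integral_cmult_indicator ap measure_pmf.emeasure_eq_measure)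
    also have "\<dots> = ennreal c" using pos c by (simp flip: ennreal_mult)
    finally show c1: ?c1 .
    have "ennreal c + (\<integral>\<^sup>+\<omega>'. ennreal (1 - \<rho> \<omega>') \<partial>?q) = (\<integral>\<^sup>+\<omega>'. ennreal (\<rho> \<omega>') + ennreal (1 - \<rho> \<omega>') \<partial>?q)"
      by (simp add: nn_integral_add c1)
    also have "\<dots> = (\<integral>\<^sup>+\<omega>'. 1 \<partial>?q)"
      by (intro nn_integral_cong_AE AE_pmfI) (auto simp: set_cond_pmf[OF ne] \<rho> simp flip: ennreal_plus)
    also have "\<dots> = ennreal c + ennreal (1 - c)" using c by (simp flip: ennreal_plus)
    finally show ?c2 by simp
  qed
  \<comment> \<open>The receiver's coordinate belongs to both \<open>f\<close> and \<open>g\<close>;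
    hence \<open>int\<close> applies to the integrand, and then \<open>tower\<close> can average out
    the revelation rate.\<close>
  have intR: "(\<integral>\<^sup>+x. F (snd (fst x)) (snd x) \<partial>state_message G i \<pi>') =
      ennreal c * (\<integral>\<^sup>+\<omega>. F (snd \<omega>) (receiver_opt (snd \<omega>)) \<partial>?p) +
      ennreal (1 - c) * (\<integral>\<^sup>+x. F (snd (fst x)) (snd x) \<partial>state_message G j \<pi>)" for F
  proof -
    have "(\<integral>\<^sup>+x. F (snd (fst x)) (snd x) \<partial>state_message G i \<pi>') =
      (\<integral>\<^sup>+\<omega>. ennreal (\<rho> \<omega>) * F (snd (g \<omega>)) (receiver_opt (snd (g \<omega>))) \<partial>?p) +
      (\<integral>\<^sup>+\<omega>. ennreal (1 - \<rho> \<omega>) * (\<integral>\<^sup>+a. F (snd (g \<omega>)) a \<partial>\<pi> (g \<omega>)) \<partial>?p)"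
      using int[of "\<lambda>y. F (snd y)"] by (simp add: f_def g_def)
    also have "\<dots> = ennreal c * (\<integral>\<^sup>+\<omega>. F (snd (g \<omega>)) (receiver_opt (snd (g \<omega>))) \<partial>?p) +
      ennreal (1 - c) * (\<integral>\<^sup>+\<omega>. \<integral>\<^sup>+a. F (snd (g \<omega>)) a \<partial>\<pi> (g \<omega>) \<partial>?p)"
      by (subst tower[OF cond_\<rho>, where H = "\<lambda>y. F (snd y) (receiver_opt (snd y))"], assumption,
          subst tower[OF cond_\<rho>', where H = "\<lambda>y. \<integral>\<^sup>+a. F (snd y) a \<partial>\<pi> y"], assumption) (rule refl)
    finally show ?thesis by (simp add: nn_integral_state_message g_def)
  qed
  have "obedient i \<pi>'"
    unfolding obedient_def
  proof (intro ballI)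
    fix a b assume ab: "a \<in> actions G" "b \<in> actions G"
    have zero: "(\<integral>\<^sup>+\<omega>. receiver_loss a (snd \<omega>) * indicator {a} (receiver_opt (snd \<omega>)) \<partial>?p) = 0"
      by (subst nn_integral_0_iff_AE) (auto simp: indicator_def)
    show "(\<integral>\<^sup>+x. receiver_loss a (snd (fst x)) * indicator {a} (snd x) \<partial>state_message G i \<pi>')
     \<le> (\<integral>\<^sup>+x. receiver_loss b (snd (fst x)) * indicator {a} (snd x) \<partial>state_message G i \<pi>')"
      using v(2) ab
      unfolding intR[of "\<lambda>r m. receiver_loss a r * indicator {a} m"] intR[of "\<lambda>r m. receiver_loss b r * indicator {a} m"] zero
      by (intro add_mono mult_left_mono) (auto simp: obedient_def)
  qed
  then have IC: "\<pi>' \<in> IC_signals G i" using valid by (simp add: IC_signals_iff)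
  have risk: "receiver_risk i \<pi>' = ennreal (1 - c) * receiver_risk j \<pi>"
    using intR[of "\<lambda>r m. receiver_loss m r"] by (simp add: receiver_risk_def)
  define Z where "Z \<omega> = (\<integral>\<^sup>+a. sender_loss i a (fst \<omega> i) \<partial>\<pi> (g \<omega>))" for \<omega>
  \<comment> \<open>Revelation happens only in aligned states, where the receiver's optimum is also
    optimal for sender \<open>i\<close>.\<close>
  have zero: "(\<integral>\<^sup>+\<omega>. ennreal (\<rho> \<omega>) * sender_loss i (receiver_opt (snd \<omega>)) (fst \<omega> i) \<partial>?p) = 0"
    by (subst nn_integral_0_iff_AE, simp, intro AE_pmfI)
       (auto simp: \<rho>_def aligned_def sender_loss_def)
  have S': "sender_risk i i \<pi>' = (\<integral>\<^sup>+\<omega>. ennreal (1 - \<rho> \<omega>) * Z \<omega> \<partial>?p)"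
    using int[of "\<lambda>y a. sender_loss i a (fst y)"] zero by (simp add: sender_risk_def f_def Z_def)
  have "sender_risk i j \<pi> = (\<integral>\<^sup>+\<omega>. Z \<omega> \<partial>?p)"
    by (simp add: sender_risk_def nn_integral_state_message Z_def g_def)
  also have "\<dots> = (\<integral>\<^sup>+\<omega>. ennreal (1 - \<rho> \<omega>) * Z \<omega> + ennreal (\<rho> \<omega>) * Z \<omega> \<partial>?p)"
    by (intro nn_integral_cong_AE AE_pmfI) (auto simp: \<rho> simp flip: distrib_right ennreal_plus)
  finally have S: "sender_risk i j \<pi> = sender_risk i i \<pi>' + (\<integral>\<^sup>+\<omega>. ennreal (\<rho> \<omega>) * Z \<omega> \<partial>?p)"
    by (simp add: S' nn_integral_add)
  \<comment> \<open>A message of \<open>\<pi>\<close> has positive probability throughout the fibre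
    of \<open>g\<close>, in particular in an aligned state of it. If revelation there gains nothing,
    the message is already optimal for sender \<open>i\<close> in the aligned state, hence equals
    the receiver's optimum.\<close>
  have gain: "receiver_risk j \<pi> = 0" if zero: "(\<integral>\<^sup>+\<omega>. ennreal (\<rho> \<omega>) * Z \<omega> \<partial>?p) = 0"
  proof -
    have all0: "\<rho> \<omega> = 0 \<or> Z \<omega> = 0" if "\<omega> \<in> set_pmf ?p" for \<omega>
      using zero \<rho>[OF that] that by (auto simp: nn_integral_0_iff_AE AE_measure_pmf_iff ennreal_eq_0_iff)
    have "receiver_loss (snd x) (snd (fst x)) = 0" if x: "x \<in> set_pmf (state_message G j \<pi>)" for x
    proof -
      have \<omega>: "fst x \<in> set_pmf ?p" and m: "snd x \<in> set_pmf (\<pi> (g (fst x)))"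
        using x by (auto simp: set_state_message g_def)
      obtain \<omega>' where \<omega>': "\<omega>' \<in> set_pmf ?p" "fst \<omega>' j = fst (fst x) j" "snd \<omega>' = snd (fst x)"
        "sender_opt i (fst \<omega>' i) = receiver_opt (snd \<omega>')"
        using aligned_state[OF ij \<omega>] by blast
      then have "aligned i \<omega>'" by (simp add: aligned_def)
      then have "\<rho> \<omega>' \<noteq> 0" using c c_le[OF \<omega>'(1)] by (simp add: \<rho>_def)
      with all0[OF \<omega>'(1)] have "Z \<omega>' = 0" by simp
      moreover have "g \<omega>' = g (fst x)" using \<omega>' by (simp add: g_def)
      ultimately have "sender_loss i (snd x) (fst \<omega>' i) = 0"
        using m by (auto simp: Z_def nn_integral_0_iff_AE AE_measure_pmf_iff)
      then have "snd x = sender_opt i (fst \<omega>' i)"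
        using sender_loss_eq_0_iff prior_states(1)[OF \<omega>'(1)] state_message_props(3)[OF v(1) x] by blast
      then show ?thesis using \<omega>' by simp
    qed
    then show ?thesis by (auto simp: receiver_risk_def nn_integral_0_iff_AE AE_measure_pmf_iff)
  qed
  show ?thesis
  proof (rule that[OF IC risk])
    show "sender_risk i i \<pi>' \<le> sender_risk i j \<pi>" by (simp add: S)
    show "receiver_risk j \<pi> > 0 \<longrightarrow> sender_risk i j \<pi> < \<infinity> \<longrightarrow> sender_risk i i \<pi>' < sender_risk i j \<pi>"
    proof (intro impI)
      assume "receiver_risk j \<pi> > 0" "sender_risk i j \<pi> < \<infinity>"
      then have "(\<integral>\<^sup>+\<omega>. ennreal (\<rho> \<omega>) * Z \<omega> \<partial>?p) \<noteq> 0" "sender_risk i i \<pi>' \<noteq> \<infinity>" using gain S by auto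
      then show "sender_risk i i \<pi>' < sender_risk i j \<pi>"
        using ennreal_add_left_cancel_less[of "sender_risk i i \<pi>'" 0] by (simp add: S zero_less_iff_neq_zero)
    qed
  qed
qed

section \<open>Risks of strategy profiles\<close>

lemma space_signal_space: "space (signal_space G j) = IC_signals G j"
proof -
  have "IC_signals G j \<subseteq> space (\<Pi>\<^sub>M w\<in>sender_states G j \<times> receiver_states G. pmf_algebra)"
    by (auto simp: IC_signals_iff valid_signal_def space_PiM pmf_algebra_def PiE_def)
  then show ?thesis unfolding signal_space_def space_restrict_space by blast
qed

text \<open>The prior has finite support, so the integral is a finite weighted sum of integrals
  against single components of the signal.\<close>

lemma measurable_nn_integral_state_message:
  "(\<lambda>\<pi>. \<integral>\<^sup>+x. F x \<partial>state_message G j \<pi>) \<in> borel_measurable (signal_space G j)"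
proof -
  have comp: "(\<lambda>\<pi>. \<pi> (fst \<omega> j, snd \<omega>)) \<in> signal_space G j \<rightarrow>\<^sub>M pmf_algebra" if "\<omega> \<in> set_pmf (prior G)" for \<omega>
    unfolding signal_space_def
    by (intro measurable_restrict_space1 measurable_component_singleton) (use prior_states[OF that] in auto)
  have "(\<lambda>\<pi>. \<Sum>\<omega>\<in>set_pmf (prior G). (\<integral>\<^sup>+a. F (\<omega>, a) \<partial>measure_pmf (\<pi> (fst \<omega> j, snd \<omega>))) * ennreal (pmf (prior G) \<omega>))
    \<in> borel_measurable (signal_space G j)"
    by (intro borel_measurable_sum borel_measurable_times_ennreal borel_measurable_const
        measurable_compose[OF comp borel_measurable_nn_integral_pmf_algebra])
  then show ?thesis
    by (simp add: nn_integral_state_message nn_integral_measure_pmf_finite finite_prior)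
qed

lemma measurable_receiver_risk [measurable]: "receiver_risk j \<in> borel_measurable (signal_space G j)"
  using measurable_nn_integral_state_message unfolding receiver_risk_def[abs_def] .

lemma measurable_sender_risk [measurable]: "sender_risk i j \<in> borel_measurable (signal_space G j)"
  using measurable_nn_integral_state_message unfolding sender_risk_def[abs_def] .

section \<open>Winners and the average risk at a profile\<close>

definition winners :: "('i \<Rightarrow> ('s, 'r, 'a) signal) \<Rightarrow> 'i set" where
  "winners \<pi> = {j. \<forall>k. receiver_risk j (\<pi> j) \<le> receiver_risk k (\<pi> k)}"

lemma winners_nonempty: "winners \<pi> \<noteq> {}"
proof -
  let ?R = "range (\<lambda>k. receiver_risk k (\<pi> k))"
  have "Min ?R \<in> ?R" by (intro Min_in) auto
  then obtain j where j: "Min ?R = receiver_risk j (\<pi> j)" by (rule rangeE)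
  have "Min ?R \<le> receiver_risk k (\<pi> k)" for k by (intro Min_le) auto
  then have "j \<in> winners \<pi>" by (simp add: winners_def j)
  then show ?thesis by auto
qed

text \<open>The receiver's values are one real constant minus the risks, and these are finite, so
  comparing values reverses the comparison of risks.\<close>

lemma decision_eq:
  assumes "\<And>k. \<pi> k \<in> IC_signals G k"
  shows "decision G \<pi> = pmf_of_set (winners \<pi>)"
proof -
  have fin: "receiver_risk k (\<pi> k) < \<infinity>" for k
    using receiver_risk_bound assms by (metis ennreal_less_top infinity_ennreal_def order.strict_trans1)
  have "receiver_value G i (\<pi> i) \<le> receiver_value G j (\<pi> j) \<longleftrightarrow> receiver_risk j (\<pi> j) \<le> receiver_risk i (\<pi> i)" for i j
  proof -
    obtain x y where "receiver_risk i (\<pi> i) = ennreal x" "0 \<le> x" "receiver_risk j (\<pi> j) = ennreal y" "0 \<le> y"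
      using fin by (metis ennreal_cases infinity_ennreal_def less_irrefl)
    moreover have "valid_signal i (\<pi> i)" "valid_signal j (\<pi> j)" using assms by (auto simp: IC_signals_iff)
    ultimately show ?thesis by (simp add: receiver_value_eq enn2ereal_ennreal)
  qed
  then show ?thesis by (simp add: decision_def winners_def)
qed

text \<open>The quotient form suits the measurability proof and the sums over winners;
  \<open>profile_risk_eq\<close> is the form that the decision rule produces.\<close>

definition profile_risk :: "'i \<Rightarrow> ('i \<Rightarrow> ('s, 'r, 'a) signal) \<Rightarrow> ennreal" where
  "profile_risk i \<pi> = (\<Sum>j\<in>winners \<pi>. sender_risk i j (\<pi> j)) / of_nat (card (winners \<pi>))"

lemma profile_risk_eq: "profile_risk i \<pi> = (\<integral>\<^sup>+j. sender_risk i j (\<pi> j) \<partial>pmf_of_set (winners \<pi>))"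
  using winners_nonempty by (simp add: profile_risk_def nn_integral_pmf_of_set ennreal_of_nat_eq_real_of_nat)

abbreviation profiles :: "('i \<Rightarrow> ('s, 'r, 'a) signal) measure" where
  "profiles \<equiv> \<Pi>\<^sub>M j\<in>UNIV. signal_space G j"

lemma space_profiles: "\<pi> \<in> space profiles \<longleftrightarrow> (\<forall>j. \<pi> j \<in> IC_signals G j)"
  by (auto simp: space_PiM space_signal_space)

lemma measurable_receiver_risk_component [measurable]:
  "(\<lambda>\<pi>. receiver_risk j (\<pi> j)) \<in> borel_measurable profiles"
  by (rule measurable_compose[where f = "\<lambda>\<pi>. \<pi> j" and N = "signal_space G j"])
     (simp_all add: measurable_receiver_risk)

lemma measurable_sender_risk_component [measurable]:
  "(\<lambda>\<pi>. sender_risk i j (\<pi> j)) \<in> borel_measurable profiles"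
  by (rule measurable_compose[where f = "\<lambda>\<pi>. \<pi> j" and N = "signal_space G j"])
     (simp_all add: measurable_sender_risk)

lemma measurable_mem_winners [measurable]: "Measurable.pred profiles (\<lambda>\<pi>. j \<in> winners \<pi>)"
  proof -
  have "Measurable.pred profiles (\<lambda>\<pi>. receiver_risk j (\<pi> j) \<le> receiver_risk k (\<pi> k))" for k
    unfolding pred_def
    by (intro borel_measurable_le measurable_receiver_risk_component)
  then show ?thesis by (simp add: winners_def)
qed

lemma measurable_card_winners [measurable]: "(\<lambda>\<pi>. real (card (winners \<pi>))) \<in> borel_measurable profiles"
proof -
  have "real (card (winners \<pi>)) = (\<Sum>j\<in>UNIV. if j \<in> winners \<pi> then 1 else 0)" for \<pi>
    by (simp flip: sum.inter_filter)
  then show ?thesis by simp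
qed

lemma measurable_profile_risk [measurable]: "profile_risk i \<in> borel_measurable profiles"
proof -
  have "profile_risk i = (\<lambda>\<pi>. (\<Sum>j\<in>UNIV. if j \<in> winners \<pi> then sender_risk i j (\<pi> j) else 0) / ennreal (real (card (winners \<pi>))))"
    by (auto simp: profile_risk_def ennreal_of_nat_eq_real_of_nat simp flip: sum.inter_filter)
  then show ?thesis by simp
qed

section \<open>Payoffs and deviations in terms of risks\<close>

lemma mixed_strategiesD:
  assumes "\<tau> \<in> mixed_strategies G j"
  shows "prob_space \<tau>" "sets \<tau> = sets (signal_space G j)"
  using assms by (auto simp: mixed_strategies_def space_prob_algebra)

text \<open>Two applications of \<open>expect_diff\<close>, first to the decision rule and then to
  the draw of the profile. Maximising the payoff is thereby the same as minimising the expected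
  risk.\<close>

lemma expected_payoff_eq:
  assumes \<sigma>: "\<And>j. \<sigma> j \<in> mixed_strategies G j"
  shows "expected_payoff G i \<sigma> = ereal (sender_max i) - enn2ereal (\<integral>\<^sup>+\<pi>. profile_risk i \<pi> \<partial>PiM UNIV \<sigma>)"
proof -
  have s: "sets (PiM UNIV \<sigma>) = sets profiles"
    using mixed_strategiesD(2)[OF \<sigma>] by (intro sets_PiM_cong) auto
  interpret prob_space "PiM UNIV \<sigma>" using mixed_strategiesD(1)[OF \<sigma>] by (intro prob_space_PiM)
  have "expect (decision G \<pi>) (\<lambda>j. sender_value G i j (\<pi> j)) = ereal (sender_max i) - enn2ereal (profile_risk i \<pi>)"
    if "\<pi> \<in> space (PiM UNIV \<sigma>)" for \<pi>
  proof -
    have IC: "\<pi> k \<in> IC_signals G k" for k using that sets_eq_imp_space_eq[OF s] space_profiles by auto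
    then have "valid_signal k (\<pi> k)" for k by (simp add: IC_signals_iff)
    then have "expect (decision G \<pi>) (\<lambda>j. sender_value G i j (\<pi> j)) =
      expect (pmf_of_set (winners \<pi>)) (\<lambda>j. ereal (sender_max i) - enn2ereal (sender_risk i j (\<pi> j)))"
      by (simp add: decision_eq[OF IC] sender_value_eq)
    also have "\<dots> = ereal (sender_max i) - enn2ereal (profile_risk i \<pi>)"
      by (subst expect_diff) (auto simp: profile_risk_eq)
    finally show ?thesis .
  qed
  then have "expected_payoff G i \<sigma> = expect (PiM UNIV \<sigma>) (\<lambda>\<pi>. ereal (sender_max i) - enn2ereal (profile_risk i \<pi>))"
    unfolding expected_payoff_def by (rule expect_cong)
  also have "\<dots> = ereal (sender_max i) - enn2ereal (\<integral>\<^sup>+\<pi>. profile_risk i \<pi> \<partial>PiM UNIV \<sigma>)"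
    by (subst expect_diff) (auto simp: measurable_cong_sets[OF s refl] prob_space)
  finally show ?thesis .
qed

text \<open>Sender \<open>i\<close> draws from his equilibrium strategy and then modifies the draw
  by \<open>f\<close>. Both sides are integrals over the same draw of the profile, so they can be
  compared pointwise.\<close>

lemma nash_deviation:
  assumes nash: "nash_equilibrium G \<sigma>" and f [measurable]: "f \<in> signal_space G i \<rightarrow>\<^sub>M signal_space G i"
  shows "(\<integral>\<^sup>+\<pi>. profile_risk i \<pi> \<partial>PiM UNIV \<sigma>) \<le> (\<integral>\<^sup>+\<pi>. profile_risk i (\<pi>(i := f (\<pi> i))) \<partial>PiM UNIV \<sigma>)"
proof -
  have \<sigma>: "\<sigma> j \<in> mixed_strategies G j" for j using nash by (simp add: nash_equilibrium_def)
  note p = mixed_strategiesD[OF \<sigma>]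
  have s: "sets (PiM UNIV \<sigma>) = sets profiles"
    using p(2) by (intro sets_PiM_cong) auto
  have f': "f \<in> \<sigma> i \<rightarrow>\<^sub>M \<sigma> i" by (simp add: measurable_cong_sets[OF p(2) p(2)])
  let ?\<tau> = "distr (\<sigma> i) (\<sigma> i) f"
  have \<tau>: "?\<tau> \<in> mixed_strategies G i"
    using prob_space.prob_space_distr[OF p(1) f'] p(2) by (simp add: mixed_strategies_def space_prob_algebra)
  have \<sigma>': "(\<sigma>(i := ?\<tau>)) j \<in> mixed_strategies G j" for j using \<sigma> \<tau> by simp
  have le: "expected_payoff G i (\<sigma>(i := ?\<tau>)) \<le> expected_payoff G i \<sigma>"
    using nash \<tau> by (auto simp: nash_equilibrium_def not_less)
  have *: "a \<le> b" if "ereal m - enn2ereal b \<le> ereal m - enn2ereal a" for a b m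
    using that by (cases a; cases b) (auto simp: enn2ereal_ennreal intro: ennreal_leI)
  have "(\<integral>\<^sup>+\<pi>. profile_risk i \<pi> \<partial>PiM UNIV \<sigma>) \<le> (\<integral>\<^sup>+\<pi>. profile_risk i \<pi> \<partial>PiM UNIV (\<sigma>(i := ?\<tau>)))"
    using le by (intro *[of "sender_max i"]) (simp only: expected_payoff_eq[OF \<sigma>] expected_payoff_eq[of "\<sigma>(i := ?\<tau>)", OF \<sigma>'])
  also have "\<dots> = (\<integral>\<^sup>+\<pi>. profile_risk i (\<pi>(i := f (\<pi> i))) \<partial>PiM UNIV \<sigma>)"
  proof -
    have "(\<lambda>\<pi>. \<pi>(i := f (\<pi> i))) \<in> PiM UNIV \<sigma> \<rightarrow>\<^sub>M PiM UNIV \<sigma>"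
      by (rule measurable_fun_upd_component[of f \<sigma> i, OF f'])
    then show ?thesis
      unfolding PiM_fun_upd_distr[of \<sigma> f i, OF p(1) f']
      by (intro nn_integral_distr) (auto simp: measurable_cong_sets[OF s refl])
  qed
  finally show ?thesis .
qed

section \<open>The frontier of a sender\<close>

text \<open>The strict bound on the receiver's risk lets a signal that nearly attains the infimum
  undercut every rival whose risk is above \<open>x\<close>. Infinite sender risks must be excluded
  because \<open>enn2real\<close> sends them to 0.\<close>

definition frontier :: "'i \<Rightarrow> real \<Rightarrow> real" where
  "frontier i x = Inf {enn2real (sender_risk i i \<pi>) | \<pi>.
     \<pi> \<in> IC_signals G i \<and> receiver_risk i \<pi> < ennreal x \<and> sender_risk i i \<pi> < \<infinity>}"

lemma frontier_lower:
  assumes "\<pi> \<in> IC_signals G i" "receiver_risk i \<pi> < ennreal x" "sender_risk i i \<pi> < \<infinity>"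
  shows "frontier i x \<le> enn2real (sender_risk i i \<pi>)"
  unfolding frontier_def using assms by (intro cInf_lower bdd_belowI[of _ 0]) auto

lemma frontier_set_nonempty:
  assumes "x > 0"
  shows "{enn2real (sender_risk i i \<pi>) | \<pi>.
     \<pi> \<in> IC_signals G i \<and> receiver_risk i \<pi> < ennreal x \<and> sender_risk i i \<pi> < \<infinity>} \<noteq> {}"
proof -
  obtain \<pi> where "\<pi> \<in> IC_signals G i" "receiver_risk i \<pi> = 0" by (rule full_signal)
  moreover from this have "sender_risk i i \<pi> < \<infinity>"
    using sender_risk_full full_risk_finite by (simp add: IC_signals_iff)
  ultimately show ?thesis using assms by force
qed

lemma frontier_nonneg: "x > 0 \<Longrightarrow> frontier i x \<ge> 0"
  unfolding frontier_def by (rule cInf_greatest[OF frontier_set_nonempty]) auto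

lemma frontier_attained:
  assumes "x > 0" "e > 0"
  obtains \<pi> where "\<pi> \<in> IC_signals G i" "receiver_risk i \<pi> < ennreal x" "sender_risk i i \<pi> \<le> ennreal (frontier i x + e)"
proof -
  have "frontier i x < frontier i x + e" using assms by simp
  then obtain \<pi> where \<pi>: "\<pi> \<in> IC_signals G i" "receiver_risk i \<pi> < ennreal x" "sender_risk i i \<pi> < \<infinity>"
    "enn2real (sender_risk i i \<pi>) < frontier i x + e"
    unfolding frontier_def using cInf_lessD[OF frontier_set_nonempty[OF assms(1)]] by blast
  have "sender_risk i i \<pi> = ennreal (enn2real (sender_risk i i \<pi>))" using \<pi>(3) by simp
  also have "\<dots> \<le> ennreal (frontier i x + e)" using \<pi>(4) by (intro ennreal_leI) simp
  finally show ?thesis using \<pi> that by blast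
qed

lemma frontier_antimono: "0 < x \<Longrightarrow> x \<le> y \<Longrightarrow> frontier i y \<le> frontier i x"
  unfolding frontier_def
  by (intro cInf_superset_mono[OF frontier_set_nonempty] bdd_belowI[of _ 0])
     (auto intro: order.strict_trans2 ennreal_leI)

text \<open>Mix signals that nearly attain the infimum at \<open>x\<close> and at \<open>y\<close>;
  both risks are affine under mixing.\<close>

lemma convex_on_frontier: "convex_on {0<..} (frontier i)"
proof (rule convex_onI)
  fix t x y :: real assume t: "0 < t" "t < 1" and xy: "x \<in> {0<..}" "y \<in> {0<..}"
  show "frontier i ((1 - t) *\<^sub>R x + t *\<^sub>R y) \<le> (1 - t) * frontier i x + t * frontier i y"
  proof (rule field_le_epsilon)
    fix e :: real assume e: "e > 0"
    obtain \<pi> where \<pi>: "\<pi> \<in> IC_signals G i" "receiver_risk i \<pi> < ennreal x" "sender_risk i i \<pi> \<le> ennreal (frontier i x + e)"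
      using frontier_attained xy(1) e by (metis greaterThan_iff)
    obtain \<pi>' where \<pi>': "\<pi>' \<in> IC_signals G i" "receiver_risk i \<pi>' < ennreal y" "sender_risk i i \<pi>' \<le> ennreal (frontier i y + e)"
      using frontier_attained xy(2) e by (metis greaterThan_iff)
    obtain \<rho> where \<rho>: "\<rho> \<in> IC_signals G i"
      "receiver_risk i \<rho> = ennreal (1 - t) * receiver_risk i \<pi> + ennreal (1 - (1 - t)) * receiver_risk i \<pi>'"
      "sender_risk i i \<rho> = ennreal (1 - t) * sender_risk i i \<pi> + ennreal (1 - (1 - t)) * sender_risk i i \<pi>'"
      using mix_signal[OF \<pi>(1) \<pi>'(1), of "1 - t"] t by auto
    obtain X where X: "receiver_risk i \<pi> = ennreal X" "X \<ge> 0" using \<pi>(2) by (cases "receiver_risk i \<pi>") auto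
    obtain X' where X': "receiver_risk i \<pi>' = ennreal X'" "X' \<ge> 0" using \<pi>'(2) by (cases "receiver_risk i \<pi>'") auto
    obtain S where S: "sender_risk i i \<pi> = ennreal S" "S \<ge> 0"
      using \<pi>(3) by (cases "sender_risk i i \<pi>") (auto simp: top_unique)
    obtain S' where S': "sender_risk i i \<pi>' = ennreal S'" "S' \<ge> 0"
      using \<pi>'(3) by (cases "sender_risk i i \<pi>'") (auto simp: top_unique)
    have R: "receiver_risk i \<rho> = ennreal ((1 - t) * X + t * X')" "sender_risk i i \<rho> = ennreal ((1 - t) * S + t * S')"
      using t X X' S S' \<rho> by (simp_all add: ennreal_plus ennreal_mult)
    have "X < x" "X' < y" using \<pi>(2) \<pi>'(2) X X' by (auto simp: ennreal_less_iff)
    then have "(1 - t) * X + t * X' < (1 - t) * x + t * y" using t by (intro add_strict_mono mult_strict_left_mono) auto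
    then have "frontier i ((1 - t) *\<^sub>R x + t *\<^sub>R y) \<le> enn2real (sender_risk i i \<rho>)"
      using R X X' t by (intro frontier_lower \<rho>(1)) (auto simp: ennreal_less_iff simp del: ennreal_plus)
    also have "\<dots> = (1 - t) * S + t * S'" using R S S' t by (simp del: ennreal_plus)
    also have "\<dots> \<le> (1 - t) * (frontier i x + e) + t * (frontier i y + e)"
      using \<pi>(3) \<pi>'(3) S S' t e xy frontier_nonneg[of x i] frontier_nonneg[of y i]
      by (intro add_mono mult_left_mono) (auto simp del: ennreal_plus)
    also have "\<dots> = (1 - t) * frontier i x + t * frontier i y + e" by (simp add: algebra_simps)
    finally show "frontier i ((1 - t) *\<^sub>R x + t *\<^sub>R y) \<le> (1 - t) * frontier i x + t * frontier i y + e" .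
  qed
qed (simp add: convex_real_interval)

text \<open>A convex function has a subgradient \<open>m\<close> at the interior point
  \<open>T\<close>, and monotonicity makes it nonpositive; \<open>l\<close> is \<open>- m\<close>.
  Where the line is negative, \<open>ennreal\<close> cuts it to 0 and the bound is trivial.\<close>

lemma frontier_supporting_line:
  assumes T: "T > 0"
  obtains l where "l \<ge> 0"
    "\<forall>\<pi>\<in>IC_signals G i. ennreal (frontier i T + l * (T - enn2real (receiver_risk i \<pi>))) \<le> sender_risk i i \<pi>"
proof -
  obtain m where m: "frontier i x \<ge> frontier i T + m * (x - T)" if "x > 0" for x
    using convex_le_Inf_differential[OF convex_on_frontier[of i], of T] T by (auto simp: interior_open)
  have "m \<le> 0" using m[of "T + 1"] frontier_antimono[of T "T + 1" i] T by auto
  moreover have "ennreal (frontier i T - m * (T - enn2real (receiver_risk i \<pi>))) \<le> sender_risk i i \<pi>"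
    if \<pi>: "\<pi> \<in> IC_signals G i" for \<pi>
  proof (cases "sender_risk i i \<pi>")
    case (real y)
    obtain X where X: "receiver_risk i \<pi> = ennreal X" "X \<ge> 0"
      using receiver_risk_bound \<pi> by (metis ennreal_cases ennreal_neq_top neq_top_trans)
    have "frontier i T - m * (T - X) \<le> y"
    proof (rule field_le_epsilon)
      fix e :: real assume e: "e > 0"
      \<comment> \<open>The strict bound in \<open>frontier\<close> does not admit
        \<open>\<pi>\<close> at \<open>X\<close> itself, so the line is evaluated slightly to the
        right, which also covers \<open>X = 0\<close>. Dividing by \<open>1 - m\<close> rather than
        \<open>- m\<close> avoids division by 0.\<close>
      define x where "x = X + e / (1 - m)"
      have x: "x > X" using e \<open>m \<le> 0\<close> by (simp add: x_def)
      have "frontier i T + m * (x - T) \<le> frontier i x" using m x X by simp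
      also have "\<dots> \<le> y"
        using frontier_lower[OF \<pi>, of x] x X real by (simp add: ennreal_less_iff)
      finally have "frontier i T + m * (x - T) \<le> y" .
      moreover have "m * (x - X) \<ge> - e"
      proof -
        have "- m * (e / (1 - m)) \<le> e" using e \<open>m \<le> 0\<close> by (simp add: field_simps)
        then show ?thesis by (simp add: x_def)
      qed
      ultimately show "frontier i T - m * (T - X) \<le> y + e" by (simp add: algebra_simps)
    qed
    then show ?thesis using X real by (simp add: ennreal_leI)
  qed simp
  ultimately show ?thesis by (intro that[of "- m"]) auto
qed

section \<open>Averages over the winners\<close>

lemma finite_receiver_risk:
  assumes "\<pi> \<in> IC_signals G j"
  shows "receiver_risk j \<pi> = ennreal (enn2real (receiver_risk j \<pi>))"
proof -
  obtain B where "receiver_risk j \<pi> \<le> ennreal B" using receiver_risk_bound assms by metis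
  then show ?thesis by (cases "receiver_risk j \<pi>") (auto simp: top_unique)
qed

lemma sum_winners: "(\<Sum>j\<in>winners \<pi>. sender_risk i j (\<pi> j)) = of_nat (card (winners \<pi>)) * profile_risk i \<pi>"
  using winners_nonempty
  by (simp add: profile_risk_def ennreal_times_divide mult_divide_eq_ennreal mult.commute[of "of_nat _"])

lemma profile_risk_le:
  assumes "(\<Sum>j\<in>winners \<pi>. sender_risk i j (\<pi> j)) \<le> of_nat (card (winners \<pi>)) * m"
  shows "profile_risk i \<pi> \<le> m"
proof -
  have "profile_risk i \<pi> \<le> (m * of_nat (card (winners \<pi>))) / of_nat (card (winners \<pi>))"
    unfolding profile_risk_def using assms by (intro divide_right_mono_ennreal) (simp add: mult.commute)
  also have "\<dots> = m" using winners_nonempty by (intro mult_divide_eq_ennreal) auto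
  finally show ?thesis .
qed

lemma profile_risk_ge:
  assumes "\<And>j. j \<in> winners \<pi> \<Longrightarrow> m \<le> sender_risk i j (\<pi> j)"
  shows "m \<le> profile_risk i \<pi>"
proof -
  have "m = (m * of_nat (card (winners \<pi>))) / of_nat (card (winners \<pi>))"
    using winners_nonempty by (intro mult_divide_eq_ennreal[symmetric]) auto
  also have "\<dots> \<le> profile_risk i \<pi>"
    unfolding profile_risk_def using sum_mono[of "winners \<pi>" "\<lambda>_. m", OF assms]
    by (intro divide_right_mono_ennreal) (simp add: mult.commute)
  finally show ?thesis .
qed

lemma profile_risk_undercut:
  assumes "\<And>j. receiver_risk i \<rho> < receiver_risk j (\<pi> j)"
  shows "profile_risk i (\<pi>(i := \<rho>)) = sender_risk i i \<rho>"
proof -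
  have "j \<in> winners (\<pi>(i := \<rho>)) \<longleftrightarrow> j = i" for j
  proof (cases "j = i")
    case False
    then have "\<not> receiver_risk j ((\<pi>(i := \<rho>)) j) \<le> receiver_risk i ((\<pi>(i := \<rho>)) i)"
      using assms[of j] by (simp add: not_le)
    then show ?thesis using False unfolding winners_def by blast
  qed (use assms in \<open>auto simp: winners_def intro: less_imp_le\<close>)
  then have "winners (\<pi>(i := \<rho>)) = {i}" by auto
  then show ?thesis by (simp add: profile_risk_eq pmf_of_set_singleton)
qed

lemma mem_winners_iff:
  assumes "\<And>k. m \<le> receiver_risk k (\<pi> k)" "receiver_risk k (\<pi> k) = m"
  shows "j \<in> winners \<pi> \<longleftrightarrow> receiver_risk j (\<pi> j) = m"
  using assms unfolding winners_def by (auto intro: antisym)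

text \<open>As sender \<open>i\<close> was not winning, the minimal risk of the others is unchanged.
  With \<open>\<rho>\<close> he wins alone, joins the tie, or still loses; in each case the new
  average combines the risk of \<open>\<rho>\<close> and the old average.\<close>

lemma profile_risk_fun_upd_le:
  assumes i: "i \<notin> winners \<pi>" and le: "sender_risk i i \<rho> \<le> profile_risk i \<pi> + \<epsilon>"
  shows "profile_risk i (\<pi>(i := \<rho>)) \<le> profile_risk i \<pi> + \<epsilon>"
proof -
  obtain k where k: "k \<in> winners \<pi>" using winners_nonempty by blast
  then have ki: "k \<noteq> i" using i by auto
  define m where "m = receiver_risk k (\<pi> k)"
  have m: "m \<le> receiver_risk j (\<pi> j)" for j using k by (simp add: winners_def m_def)
  have Wm: "j \<in> winners \<pi> \<longleftrightarrow> receiver_risk j (\<pi> j) = m" for j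
    using m by (rule mem_winners_iff[of _ _ k]) (simp add: m_def)
  consider "receiver_risk i \<rho> < m" | "receiver_risk i \<rho> = m" | "receiver_risk i \<rho> > m" by (rule linorder_cases)
  then show ?thesis
  proof cases
    case 1
    have "receiver_risk i \<rho> < receiver_risk j (\<pi> j)" for j using 1 m by (rule order.strict_trans2)
    then have "profile_risk i (\<pi>(i := \<rho>)) = sender_risk i i \<rho>" by (rule profile_risk_undercut)
    then show ?thesis using le by simp
  next
    case 2
    have W': "j \<in> winners (\<pi>(i := \<rho>)) \<longleftrightarrow> receiver_risk j ((\<pi>(i := \<rho>)) j) = m" for j
      by (rule mem_winners_iff[of _ _ i]) (simp_all add: m 2)
    have W: "winners (\<pi>(i := \<rho>)) = insert i (winners \<pi>)"
    proof (rule set_eqI)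
      fix j show "j \<in> winners (\<pi>(i := \<rho>)) \<longleftrightarrow> j \<in> insert i (winners \<pi>)"
        using 2 by (cases "j = i") (simp_all add: W' Wm)
    qed
    have "(\<Sum>j\<in>winners (\<pi>(i := \<rho>)). sender_risk i j ((\<pi>(i := \<rho>)) j)) =
        sender_risk i i \<rho> + (\<Sum>j\<in>winners \<pi>. sender_risk i j ((\<pi>(i := \<rho>)) j))"
      using i by (simp add: W)
    also have "(\<Sum>j\<in>winners \<pi>. sender_risk i j ((\<pi>(i := \<rho>)) j)) = of_nat (card (winners \<pi>)) * profile_risk i \<pi>"
      unfolding sum_winners[symmetric] using i by (intro sum.cong) auto
    also have "sender_risk i i \<rho> + of_nat (card (winners \<pi>)) * profile_risk i \<pi> \<le>
        (profile_risk i \<pi> + \<epsilon>) + of_nat (card (winners \<pi>)) * (profile_risk i \<pi> + \<epsilon>)"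
      by (intro add_mono le mult_left_mono) auto
    also have "\<dots> = of_nat (card (winners (\<pi>(i := \<rho>)))) * (profile_risk i \<pi> + \<epsilon>)"
      using i by (simp add: W distrib_right)
    finally show ?thesis by (rule profile_risk_le)
  next
    case 3
    have W': "j \<in> winners (\<pi>(i := \<rho>)) \<longleftrightarrow> receiver_risk j ((\<pi>(i := \<rho>)) j) = m" for j
      by (rule mem_winners_iff[of _ _ k]) (use 3 m ki in \<open>auto simp: m_def\<close>)
    have W: "winners (\<pi>(i := \<rho>)) = winners \<pi>"
    proof (rule set_eqI)
      fix j show "j \<in> winners (\<pi>(i := \<rho>)) \<longleftrightarrow> j \<in> winners \<pi>"
        using 3 i by (cases "j = i") (simp_all add: W' Wm)
    qed
    have "(\<Sum>j\<in>winners \<pi>. sender_risk i j ((\<pi>(i := \<rho>)) j)) = (\<Sum>j\<in>winners \<pi>. sender_risk i j (\<pi> j))"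
      using i by (intro sum.cong) auto
    then have "profile_risk i (\<pi>(i := \<rho>)) = profile_risk i \<pi>" by (simp add: profile_risk_def W)
    then show ?thesis by simp
  qed
qed

section \<open>The deviation\<close>

text \<open>The minimal receiver risk is then 0, so every winner reveals fully, and full revelation
  costs sender \<open>i\<close> the same from anyone.\<close>

lemma zero_risk_profile:
  assumes "\<And>j. \<pi> j \<in> IC_signals G j" "receiver_risk k (\<pi> k) = 0"
  shows "profile_risk i \<pi> = full_risk i" "j \<in> winners \<pi> \<Longrightarrow> receiver_risk j (\<pi> j) = 0"
proof -
  show 0: "receiver_risk j (\<pi> j) = 0" if "j \<in> winners \<pi>" for j
    using that assms(2) by (metis (mono_tags, lifting) winners_def mem_Collect_eq le_zero_eq)
  have "sender_risk i j (\<pi> j) = full_risk i" if "j \<in> winners \<pi>" for j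
    using 0[OF that] assms(1)[of j] by (intro sender_risk_full) (auto simp: IC_signals_iff)
  then show "profile_risk i \<pi> = full_risk i"
    by (intro antisym profile_risk_le profile_risk_ge) simp_all
qed

lemma nash_receiver_risk:
  assumes nash: "nash_equilibrium G \<sigma>"
  shows "AE \<pi> in PiM UNIV \<sigma>. \<forall>j\<in>winners \<pi>. receiver_risk j (\<pi> j) = 0"
proof (rule ccontr)
  assume not_AE: "\<not> ?thesis"
  have \<sigma>: "\<sigma> j \<in> mixed_strategies G j" for j using nash by (simp add: nash_equilibrium_def)
  define M where "M = PiM UNIV \<sigma>"
  have s [measurable_cong]: "sets M = sets profiles"
    using mixed_strategiesD(2)[OF \<sigma>] unfolding M_def by (intro sets_PiM_cong) auto
  interpret M: prob_space M unfolding M_def using mixed_strategiesD(1)[OF \<sigma>] by (intro prob_space_PiM)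
  have IC: "\<pi> j \<in> IC_signals G j" if "\<pi> \<in> space M" for \<pi> j
    using that sets_eq_imp_space_eq[OF s] space_profiles by auto

  \<comment> \<open>Each sender can enforce \<open>full_risk\<close> by revealing fully
    himself.\<close>
  have risk_finite: "(\<integral>\<^sup>+\<pi>. profile_risk i \<pi> \<partial>M) < \<infinity>" for i
  proof -
    obtain \<phi> where \<phi>: "\<phi> \<in> IC_signals G i" "receiver_risk i \<phi> = 0" by (rule full_signal)
    have "(\<integral>\<^sup>+\<pi>. profile_risk i \<pi> \<partial>M) \<le> (\<integral>\<^sup>+\<pi>. profile_risk i (\<pi>(i := \<phi>)) \<partial>M)"
      unfolding M_def using \<phi> by (intro nash_deviation[OF nash, where f = "\<lambda>_. \<phi>"]) (simp add: space_signal_space)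
    also have "\<dots> = (\<integral>\<^sup>+\<pi>. full_risk i \<partial>M)"
      using IC \<phi> by (intro nn_integral_cong zero_risk_profile(1)[where k = i]) auto
    also have "\<dots> < \<infinity>" using full_risk_finite[of i] by (simp add: M.emeasure_space_1)
    finally show ?thesis .
  qed

  define W where "W \<pi> = (INF j. receiver_risk j (\<pi> j))" for \<pi>
  have W_meas [measurable]: "W \<in> borel_measurable M"
    unfolding W_def by (intro borel_measurable_INF) auto
  have W_winner: "receiver_risk j (\<pi> j) = W \<pi>" if "j \<in> winners \<pi>" for j \<pi>
    unfolding W_def
  proof (rule antisym)
    show "receiver_risk j (\<pi> j) \<le> (INF k. receiver_risk k (\<pi> k))"
      using that by (intro INF_greatest) (simp add: winners_def)
  qed (rule INF_lower, simp)
  have W_le: "W \<pi> \<le> receiver_risk j (\<pi> j)" for j \<pi> unfolding W_def by (rule INF_lower) simp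
  obtain B where B: "\<And>j \<pi>. \<pi> \<in> IC_signals G j \<Longrightarrow> receiver_risk j \<pi> \<le> ennreal B"
    using receiver_risk_bound by metis
  have "W \<pi> \<le> ennreal B" if "\<pi> \<in> space M" for \<pi>
    using W_le[of \<pi> undefined] B[OF IC[OF that]] order_trans by blast
  then have "esssup M W \<le> ennreal B" by (intro esssup_I) auto
  then obtain b where b: "esssup M W = ennreal b" "b \<ge> 0"
    by (cases "esssup M W") (auto simp: top_unique)
  have W_b: "AE \<pi> in M. W \<pi> \<le> ennreal b" using esssup_AE[of W M] b by simp
  have "b \<noteq> 0"
  proof
    assume "b = 0"
    then have "AE \<pi> in M. W \<pi> = 0" using W_b by simp
    then have "AE \<pi> in M. \<forall>j\<in>winners \<pi>. receiver_risk j (\<pi> j) = 0"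
      by eventually_elim (simp add: W_winner)
    then show False using not_AE unfolding M_def by contradiction
  qed
  with b have b_pos: "b > 0" by simp

  obtain c where c: "0 < c" "c < 1" and
    c_le: "\<forall>i j. \<forall>\<omega>\<in>set_pmf (prior G). i \<noteq> j \<longrightarrow> c \<le> align_prob i j \<omega>"
    by (rule align_prob_bound)
  \<comment> \<open>\<open>T\<close> is the midpoint of \<open>b\<close> and \<open>(1 - c) * b\<close>: on \<open>E\<close> the winning risk is at most \<open>b\<close>, and imitating a
    rival with improvement brings it to at most \<open>(1 - c) * b\<close>; sender \<open>i\<close> below wins at most half of \<open>E\<close>.\<close>
  define T where "T = b - c * b / 2"
  have "0 < c * b" "c * b < b" using c b_pos by simp_all
  then have T: "0 < T" "T < b" using c by (simp_all add: T_def)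
  define E where "E = {\<pi> \<in> space M. ennreal T < W \<pi>}"
  have E [measurable]: "E \<in> sets M" unfolding E_def by measurable
  have "emeasure M E > 0"
    unfolding E_def using T b by (intro esssup_pos_measure W_meas) (auto simp: ennreal_less_iff)
  then have PE: "measure M E > 0" by (simp add: M.emeasure_eq_measure)

  \<comment> \<open>The probability that the decision rule picks sender \<open>i\<close> at the
    profile.\<close>
  define d where "d i \<pi> = (if i \<in> winners \<pi> then 1 / real (card (winners \<pi>)) else 0)" for i \<pi>
  have [measurable]: "d i \<in> borel_measurable M" for i unfolding d_def by measurable
  have d01: "0 \<le> d i \<pi>" "d i \<pi> \<le> 1" for i \<pi>
    using winners_nonempty[of \<pi>] by (auto simp: d_def Suc_le_eq card_gt_0_iff)
  have ind_int: "integrable M (indicator E :: _ \<Rightarrow> real)"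
    by (intro integrable_real_indicator) (auto simp: M.emeasure_eq_measure)
  have d_int: "integrable M (\<lambda>\<pi>. indicator E \<pi> * d i \<pi>)" for i
    by (intro M.integrable_const_bound[where B = 1]) (auto simp: d01 indicator_def)
  have d_sum: "d i \<pi> + d j \<pi> \<le> 1" if "i \<noteq> j" for i j \<pi>
  proof -
    have "d i \<pi> + d j \<pi> = (\<Sum>k\<in>{i, j}. d k \<pi>)" using that by simp
    also have "\<dots> \<le> (\<Sum>k\<in>UNIV. d k \<pi>)" by (intro sum_mono2) (auto simp: d01)
    also have "\<dots> = 1" using winners_nonempty by (simp add: d_def flip: sum.inter_filter)
    finally show ?thesis .
  qed
  \<comment> \<open>Two distinct senders win with total probability at most 1, so one of them wins
    at most half of \<open>E\<close>.\<close>
  obtain i where Di: "(\<integral>\<pi>. indicator E \<pi> * d i \<pi> \<partial>M) \<le> measure M E / 2"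
  proof -
    obtain i j :: 'i where ij: "i \<noteq> j"
    proof -
      have "\<not> CARD('i) \<le> Suc 0" using game by (simp add: persuasion_game_def)
      then show ?thesis using that by (auto simp: card_le_Suc0_iff_eq)
    qed
    have "(\<integral>\<pi>. indicator E \<pi> * d i \<pi> \<partial>M) + (\<integral>\<pi>. indicator E \<pi> * d j \<pi> \<partial>M) =
        (\<integral>\<pi>. indicator E \<pi> * d i \<pi> + indicator E \<pi> * d j \<pi> \<partial>M)"
      by (simp add: d_int)
    also have "\<dots> \<le> (\<integral>\<pi>. indicator E \<pi> \<partial>M)"
      using d_sum[OF ij]
      by (intro integral_mono Bochner_Integration.integrable_add d_int ind_int) (auto split: split_indicator)
    also have "\<dots> = measure M E" by simp
    finally have "(\<integral>\<pi>. indicator E \<pi> * d i \<pi> \<partial>M) \<le> measure M E / 2 \<or> (\<integral>\<pi>. indicator E \<pi> * d j \<pi> \<partial>M) \<le> measure M E / 2"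
      by linarith
    then show ?thesis using that by blast
  qed

  obtain l where l: "l \<ge> 0" and own: "\<forall>\<pi>\<in>IC_signals G i.
      ennreal (frontier i T + l * (T - enn2real (receiver_risk i \<pi>))) \<le> sender_risk i i \<pi>"
    by (rule frontier_supporting_line[OF T(1)])
  \<comment> \<open>The supporting line is applied not to the rival's signal but to its improvement,
    whose receiver risk is \<open>(1 - c) * x\<close>. Strictness comes from the strict gain of
    \<open>improved_signal\<close>.\<close>
  have other: "ennreal (frontier i T + l * (T - (1 - c) * x)) \<le> sender_risk i j \<pi>"
    "x > 0 \<Longrightarrow> sender_risk i j \<pi> < \<infinity> \<Longrightarrow> ennreal (frontier i T + l * (T - (1 - c) * x)) < sender_risk i j \<pi>"
    if ij: "i \<noteq> j" and \<pi>: "\<pi> \<in> IC_signals G j" and x: "x = enn2real (receiver_risk j \<pi>)" for j \<pi> x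
  proof -
    obtain \<rho> where \<rho>: "\<rho> \<in> IC_signals G i" "receiver_risk i \<rho> = ennreal (1 - c) * receiver_risk j \<pi>"
      "sender_risk i i \<rho> \<le> sender_risk i j \<pi>"
      "receiver_risk j \<pi> > 0 \<longrightarrow> sender_risk i j \<pi> < \<infinity> \<longrightarrow> sender_risk i i \<rho> < sender_risk i j \<pi>"
    proof (rule improved_signal[OF ij \<pi> c])
      show "c \<le> align_prob i j \<omega>" if "\<omega> \<in> set_pmf (prior G)" for \<omega> using c_le ij that by blast
    qed
    have "enn2real (receiver_risk i \<rho>) = (1 - c) * x"
      using c by (simp add: \<rho>(2) x enn2real_mult)
    then have le: "ennreal (frontier i T + l * (T - (1 - c) * x)) \<le> sender_risk i i \<rho>"
      using bspec[OF own \<rho>(1)] by simp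
    then show "ennreal (frontier i T + l * (T - (1 - c) * x)) \<le> sender_risk i j \<pi>"
      using \<rho>(3) by (rule order_trans)
    assume "x > 0" "sender_risk i j \<pi> < \<infinity>"
    then have "sender_risk i i \<rho> < sender_risk i j \<pi>"
      using x by (intro \<rho>(4)[rule_format]) (auto simp: enn2real_positive_iff)
    with le show "ennreal (frontier i T + l * (T - (1 - c) * x)) < sender_risk i j \<pi>"
      by (rule order.strict_trans1)
  qed

  define p where "p \<pi> = enn2real (profile_risk i \<pi>)" for \<pi>
  have p_nonneg: "0 \<le> p \<pi>" for \<pi> by (simp add: p_def)
  have p_fin: "AE \<pi> in M. profile_risk i \<pi> = ennreal (p \<pi>)"
  proof -
    have "AE \<pi> in M. profile_risk i \<pi> \<noteq> \<infinity>"
      using risk_finite[of i] by (intro nn_integral_noteq_infinite) auto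
    then show ?thesis by eventually_elim (simp add: p_def less_top)
  qed
  have [measurable]: "p \<in> borel_measurable M" unfolding p_def by measurable
  have p_nn: "(\<integral>\<^sup>+\<pi>. ennreal (p \<pi>) \<partial>M) = (\<integral>\<^sup>+\<pi>. profile_risk i \<pi> \<partial>M)"
    using p_fin by (intro nn_integral_cong_AE) auto
  have p_int: "integrable M p"
    using risk_finite[of i] by (intro integrableI_nonneg) (auto simp: p_nn, simp add: p_def)
  have p_int_E: "integrable M (\<lambda>\<pi>. indicator E \<pi> * p \<pi>)"
    using integrable_real_mult_indicator[OF E p_int] by (simp add: mult.commute)

  \<comment> \<open>The supporting line at \<open>(1 - c) * b\<close> bounds the risk of sender
    \<open>i\<close> when a rival wins. When he wins himself, the line at \<open>b\<close> gives
    \<open>r - l * c * b\<close>; averaging over the winners weights the correction by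
    \<open>d i \<pi>\<close>.\<close>
  define r where "r = frontier i T + l * (T - (1 - c) * b)"
  have lower: "AE \<pi> in M. \<pi> \<in> E \<longrightarrow> r - l * c * b * d i \<pi> \<le> p \<pi> \<and> (d i \<pi> \<noteq> 1 \<longrightarrow> r - l * c * b * d i \<pi> < p \<pi>)"
    using W_b p_fin
  proof eventually_elim
    case (elim \<pi>)
    show ?case
    proof
      assume \<pi>: "\<pi> \<in> E"
      then have space: "\<pi> \<in> space M" by (simp add: E_def)
      let ?n = "real (card (winners \<pi>))"
      have n: "?n > 0" using winners_nonempty[of \<pi>] by (simp add: card_gt_0_iff)
      define y where "y j = enn2real (sender_risk i j (\<pi> j))" for j
      \<comment> \<open>A finite average forces a finite risk at every winner, as the strict half of
        \<open>other\<close> requires.\<close>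
      have "(\<Sum>j\<in>winners \<pi>. sender_risk i j (\<pi> j)) < top"
        unfolding sum_winners elim(2) by (simp add: ennreal_mult_less_top ennreal_of_nat_eq_real_of_nat)
      then have fin: "sender_risk i j (\<pi> j) < top" if "j \<in> winners \<pi>" for j using that by simp
      then have y: "sender_risk i j (\<pi> j) = ennreal (y j)" if "j \<in> winners \<pi>" for j
        using that by (simp add: y_def)
      have y_nonneg: "0 \<le> y j" for j by (simp add: y_def)
      have "ennreal (\<Sum>j\<in>winners \<pi>. y j) = (\<Sum>j\<in>winners \<pi>. ennreal (y j))"
        by (simp add: y_nonneg)
      also have "\<dots> = (\<Sum>j\<in>winners \<pi>. sender_risk i j (\<pi> j))" by (intro sum.cong) (simp_all add: y)
      also have "\<dots> = ennreal (?n * p \<pi>)"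
        unfolding sum_winners elim(2) by (simp add: ennreal_mult p_nonneg ennreal_of_nat_eq_real_of_nat)
      finally have sum: "(\<Sum>j\<in>winners \<pi>. y j) = ?n * p \<pi>"
        by (subst (asm) ennreal_inj) (auto simp: y_nonneg p_nonneg intro!: sum_nonneg)
      have x: "0 < enn2real (receiver_risk j (\<pi> j))" "enn2real (receiver_risk j (\<pi> j)) \<le> b" if "j \<in> winners \<pi>" for j
      proof -
        have W: "W \<pi> = ennreal (enn2real (receiver_risk j (\<pi> j)))"
          unfolding W_winner[OF that, symmetric] by (rule finite_receiver_risk[OF IC[OF space]])
        show "0 < enn2real (receiver_risk j (\<pi> j))"
          using \<pi> W T(1) by (auto simp: E_def ennreal_less_iff)
        show "enn2real (receiver_risk j (\<pi> j)) \<le> b"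
          using elim(1) W b(2) by simp
      qed
      \<comment> \<open>The slack in the bound for winner \<open>j\<close>: positive for rivals,
        nonnegative for \<open>i\<close> himself. So the total slack vanishes only if
        \<open>i\<close> wins alone.\<close>
      define z where "z j = y j - r + (if j = i then l * c * b else 0)" for j
      have z_other: "0 < z j" if j: "j \<in> winners \<pi>" "j \<noteq> i" for j
      proof -
        let ?x = "enn2real (receiver_risk j (\<pi> j))"
        have "ennreal (frontier i T + l * (T - (1 - c) * ?x)) < ennreal (y j)"
          using other(2)[OF j(2)[symmetric] IC[OF space] refl] x[OF j(1)] fin[OF j(1)] y[OF j(1)] by simp
        then have "frontier i T + l * (T - (1 - c) * ?x) < y j"
          by (rule contrapos_pp) (simp add: not_less ennreal_leI)
        moreover have "l * ((1 - c) * ?x) \<le> l * ((1 - c) * b)"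
          using l c x[OF j(1)] by (intro mult_left_mono) auto
        ultimately show ?thesis using j by (simp add: z_def r_def algebra_simps)
      qed
      have z_own: "0 \<le> z i" if "i \<in> winners \<pi>"
      proof -
        let ?x = "enn2real (receiver_risk i (\<pi> i))"
        have "ennreal (frontier i T + l * (T - ?x)) \<le> ennreal (y i)"
          using bspec[OF own IC[OF space]] y[OF that] by simp
        then have "frontier i T + l * (T - ?x) \<le> y i" by (simp add: y_def ennreal_le_iff)
        moreover have "l * ?x \<le> l * b" using l x[OF that] by (intro mult_left_mono) auto
        ultimately show ?thesis by (simp add: z_def r_def algebra_simps)
      qed
      have z_nonneg: "0 \<le> z j" if "j \<in> winners \<pi>" for j
        using z_other z_own that by (cases "j = i") (auto intro: less_imp_le)
      have "(\<Sum>j\<in>winners \<pi>. z j) = ?n * p \<pi> - ?n * r + (if i \<in> winners \<pi> then l * c * b else 0)"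
        by (simp add: z_def sum.distrib sum_subtractf sum)
      also have "\<dots> = ?n * (p \<pi> - (r - l * c * b * d i \<pi>))"
        using n by (simp add: d_def field_simps)
      finally have z_sum: "(\<Sum>j\<in>winners \<pi>. z j) = ?n * (p \<pi> - (r - l * c * b * d i \<pi>))" .
      have "0 \<le> (\<Sum>j\<in>winners \<pi>. z j)" using z_nonneg by (intro sum_nonneg)
      moreover have "0 < (\<Sum>j\<in>winners \<pi>. z j)" if d: "d i \<pi> \<noteq> 1"
      proof -
        have "winners \<pi> \<noteq> {i}" using d by (auto simp: d_def)
        then obtain j where "j \<in> winners \<pi>" "j \<noteq> i" using winners_nonempty[of \<pi>] by blast
        then show ?thesis using z_other z_nonneg by (intro sum_pos2[of _ j]) auto
      qed
      ultimately show "r - l * c * b * d i \<pi> \<le> p \<pi> \<and> (d i \<pi> \<noteq> 1 \<longrightarrow> r - l * c * b * d i \<pi> < p \<pi>)"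
        using n unfolding z_sum by (auto simp: zero_le_mult_iff zero_less_mult_iff)
    qed
  qed

  have upper: "(\<integral>\<pi>. indicator E \<pi> * p \<pi> \<partial>M) \<le> measure M E * frontier i T"
  proof (rule field_le_epsilon)
    fix e :: real assume e: "e > 0"
    obtain \<rho> where \<rho>: "\<rho> \<in> IC_signals G i" "receiver_risk i \<rho> < ennreal T" "sender_risk i i \<rho> \<le> ennreal (frontier i T + e)"
      using frontier_attained[OF T(1) e] by metis
    have fr: "frontier i T \<ge> 0" using T by (intro frontier_nonneg)
    \<comment> \<open>The deviation leaves signals of receiver risk at most \<open>T\<close>
      untouched.\<close>
    define f where "f \<pi> = (if receiver_risk i \<pi> > ennreal T then \<rho> else \<pi>)" for \<pi>
    have f_meas: "f \<in> signal_space G i \<rightarrow>\<^sub>M signal_space G i"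
    proof -
      have [measurable]: "(\<lambda>_. \<rho>) \<in> signal_space G i \<rightarrow>\<^sub>M signal_space G i"
        using \<rho>(1) by (simp add: space_signal_space)
      show ?thesis unfolding f_def by measurable
    qed
    have bound: "profile_risk i (\<pi>(i := f (\<pi> i))) \<le>
        (if \<pi> \<in> E then ennreal (frontier i T + e) else profile_risk i \<pi> + ennreal e)"
      if \<pi>: "\<pi> \<in> space M" for \<pi>
    proof (cases "receiver_risk i (\<pi> i) > ennreal T")
      case False
      then have "\<pi> \<notin> E" using W_le[of \<pi> i] by (auto simp: E_def)
      then show ?thesis using False by (simp add: f_def)
    next
      case True
      show ?thesis
      proof (cases "\<pi> \<in> E")
        case E: True
        then have "receiver_risk i \<rho> < receiver_risk j (\<pi> j)" for j
          using \<rho>(2) W_le[of \<pi> j] by (auto simp: E_def)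
        then have "profile_risk i (\<pi>(i := \<rho>)) = sender_risk i i \<rho>" by (rule profile_risk_undercut)
        then show ?thesis using E True \<rho>(3) by (simp add: f_def)
      next
        case False
        then have W: "W \<pi> \<le> ennreal T" using \<pi> by (simp add: E_def)
        then have i: "i \<notin> winners \<pi>" using W_winner[of i \<pi>] True by auto
        \<comment> \<open>Outside \<open>E\<close> the winners are rivals with receiver risk at most
          \<open>T\<close>. Improving on them keeps the risk at most \<open>T\<close>, where the
          supporting line lies above \<open>frontier i T\<close>; hence switching to
          \<open>\<rho>\<close> costs at most \<open>e\<close>.\<close>
        have "ennreal (frontier i T) \<le> profile_risk i \<pi>"
        proof (rule profile_risk_ge)
          fix j assume j: "j \<in> winners \<pi>"
          let ?x = "enn2real (receiver_risk j (\<pi> j))"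
          have "receiver_risk j (\<pi> j) \<le> ennreal T" using W W_winner[OF j] by simp
          then have "ennreal ?x \<le> ennreal T" using finite_receiver_risk[OF IC[OF \<pi>], of j] by metis
          then have "?x \<le> T" using T by simp
          then have "(1 - c) * ?x \<le> 1 * T" using c by (intro mult_mono) auto
          then have "frontier i T \<le> frontier i T + l * (T - (1 - c) * ?x)" using l by simp
          then show "ennreal (frontier i T) \<le> sender_risk i j (\<pi> j)"
            using other(1)[OF _ IC[OF \<pi>] refl, of j] i j by (metis ennreal_leI order_trans)
        qed
        then have "sender_risk i i \<rho> \<le> profile_risk i \<pi> + ennreal e"
          using \<rho>(3) e fr by (simp add: ennreal_plus) (meson add_right_mono order_trans)
        then show ?thesis using profile_risk_fun_upd_le[OF i] True False by (simp add: f_def)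
      qed
    qed
    \<comment> \<open>The pointwise bound in real numbers. The finite integral of \<open>p\<close>
      occurs on both sides of the deviation inequality and cancels, leaving only the part over
      \<open>E\<close>.\<close>
    define h where "h \<pi> = indicator E \<pi> * (frontier i T + e) + (1 - indicator E \<pi>) * (p \<pi> + e)" for \<pi>
    have h_eq: "h = (\<lambda>\<pi>. indicator E \<pi> * frontier i T + p \<pi> - indicator E \<pi> * p \<pi> + e)"
      by (simp add: h_def fun_eq_iff algebra_simps)
    have iE: "integrable M (\<lambda>\<pi>. indicator E \<pi> * frontier i T)"
      by (intro M.integrable_const_bound[where B = "frontier i T"]) (auto simp: indicator_def fr)
    have h_int: "integrable M h" unfolding h_eq using p_int p_int_E iE by simp
    have h_nonneg: "0 \<le> h \<pi>" for \<pi> using fr e by (auto simp: indicator_def h_def p_def)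
    have "(\<integral>\<^sup>+\<pi>. ennreal (p \<pi>) \<partial>M) \<le> (\<integral>\<^sup>+\<pi>. profile_risk i (\<pi>(i := f (\<pi> i))) \<partial>M)"
      unfolding p_nn unfolding M_def by (rule nash_deviation[OF nash f_meas])
    also have "\<dots> \<le> (\<integral>\<^sup>+\<pi>. ennreal (h \<pi>) \<partial>M)"
    proof (rule nn_integral_mono_AE)
      show "AE \<pi> in M. profile_risk i (\<pi>(i := f (\<pi> i))) \<le> ennreal (h \<pi>)"
        using p_fin AE_space
      proof eventually_elim
        case (elim \<pi>)
        show ?case
        proof (cases "\<pi> \<in> E")
          case True
          then show ?thesis using bound[OF elim(2)] by (simp add: h_def)
        next
          case False
          have "ennreal (p \<pi> + e) = profile_risk i \<pi> + ennreal e"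
            using elim(1) e by (simp add: p_def)
          then show ?thesis using False bound[OF elim(2)] by (simp add: h_def)
        qed
      qed
    qed
    finally have "ennreal (\<integral>\<pi>. p \<pi> \<partial>M) \<le> ennreal (\<integral>\<pi>. h \<pi> \<partial>M)"
      using nn_integral_eq_integral[OF p_int] nn_integral_eq_integral[OF h_int]
      by (simp add: p_nonneg h_nonneg)
    then have "(\<integral>\<pi>. p \<pi> \<partial>M) \<le> (\<integral>\<pi>. h \<pi> \<partial>M)"
      by (simp add: ennreal_le_iff h_nonneg)
    also have "\<dots> = measure M E * frontier i T + (\<integral>\<pi>. p \<pi> \<partial>M) - (\<integral>\<pi>. indicator E \<pi> * p \<pi> \<partial>M) + e"
      unfolding h_eq using p_int p_int_E iE by (simp add: M.prob_space)
    finally show "(\<integral>\<pi>. indicator E \<pi> * p \<pi> \<partial>M) \<le> measure M E * frontier i T + e" by simp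
  qed

  \<comment> \<open>The slack in \<open>lower\<close> on \<open>E\<close>. It is nonnegative almost
    everywhere, while \<open>upper\<close> and \<open>Di\<close> make its integral at most
    0.\<close>
  let ?g = "\<lambda>\<pi>. indicator E \<pi> * p \<pi> - (r * indicator E \<pi> - l * c * b * (indicator E \<pi> * d i \<pi>))"
  have g_nonneg: "AE \<pi> in M. 0 \<le> ?g \<pi>"
    using lower by eventually_elim (auto simp: indicator_def)
  have g_int: "integrable M ?g"
    using p_int_E d_int[of i] ind_int by simp
  have "(\<integral>\<pi>. ?g \<pi> \<partial>M) = (\<integral>\<pi>. indicator E \<pi> * p \<pi> \<partial>M) - (r * measure M E - l * c * b * (\<integral>\<pi>. indicator E \<pi> * d i \<pi> \<partial>M))"
    using p_int_E d_int[of i] ind_int by simp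
  also have "\<dots> \<le> measure M E * frontier i T - (r * measure M E - l * c * b * (measure M E / 2))"
  proof -
    have "l * c * b * (\<integral>\<pi>. indicator E \<pi> * d i \<pi> \<partial>M) \<le> l * c * b * (measure M E / 2)"
      using l c b_pos by (intro mult_left_mono Di) simp
    then show ?thesis using upper by linarith
  qed
  \<comment> \<open>By the choice of \<open>T\<close>, \<open>r\<close> equals
    \<open>frontier i T + l * c * b / 2\<close>, so all terms cancel.\<close>
  also have "\<dots> = 0" by (simp add: r_def T_def algebra_simps)
  finally have "(\<integral>\<pi>. ?g \<pi> \<partial>M) = 0"
    using integral_nonneg_AE[OF g_nonneg] by simp
  then have "AE \<pi> in M. ?g \<pi> = 0"
    using integral_nonneg_eq_0_iff_AE[OF g_int g_nonneg] by simp
  \<comment> \<open>Zero slack contradicts the strict half of \<open>lower\<close> unless sender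
    \<open>i\<close> wins alone. So he would win almost surely on \<open>E\<close>, not at most half
    of it. Strictness makes this work even for \<open>l = 0\<close>.\<close>
  with lower have "AE \<pi> in M. indicator E \<pi> * d i \<pi> = indicator E \<pi>"
    by eventually_elim (auto simp: indicator_def)
  then have "(\<integral>\<pi>. indicator E \<pi> * d i \<pi> \<partial>M) = (\<integral>\<pi>. indicator E \<pi> \<partial>M)"
    by (intro integral_cong_AE) auto
  then show False using Di PE by simp
qed

end

theorem theorem1:
  fixes G :: "('i::finite, 's, 'r, 'a) game"
    and \<sigma> :: "'i \<Rightarrow> ('s, 'r, 'a) signal measure"
  assumes "persuasion_game G"
    and "unique_optimal_actions G"
    and "possible_alignment G"
    and "nash_equilibrium G \<sigma>"
  shows "fully_informative_profile G \<sigma>"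
proof -
  interpret persuasion G using assms(1-3) by unfold_locales
  have \<sigma>: "\<sigma> j \<in> mixed_strategies G j" for j using assms(4) by (simp add: nash_equilibrium_def)
  have s: "sets (PiM UNIV \<sigma>) = sets profiles"
    using mixed_strategiesD(2)[OF \<sigma>] by (intro sets_PiM_cong) auto
  show ?thesis
    unfolding fully_informative_profile_def
    using nash_receiver_risk[OF assms(4)] AE_space
  proof eventually_elim
    case (elim \<pi>)
    then have IC: "\<pi> j \<in> IC_signals G j" for j
      using sets_eq_imp_space_eq[OF s] space_profiles by auto
    have "set_pmf (decision G \<pi>) = winners \<pi>"
      using winners_nonempty by (simp add: decision_eq[OF IC])
    then show ?case using elim(1) IC by (auto intro!: fully_informativeI simp: IC_signals_iff)
  qed
qed

end
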